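(* Let $d=1$, let $R$ be an integer with $|R|\ge2$, $B\subset\mathbb{Z}$ finite with $0\in B$, $N:=|B|$, such that $\mu=\mu(R,B)$ has no overlap. Let $L\subset\mathbb{Z}$ be finite with $0\in L$ and $(\alpha_l)_{l\in L}$ complex numbers with $\alpha_0=1$ such that the matrix $\frac{1}{\sqrt N}\left(e^{2\pi i lb/R}\alpha_l\right)_{l\in L,b\in B}$ has orthonormal columns. If the only finite minimal invariant set is $\{0\}$, then the only entire function $h$ on $\mathbb{C}$ with $0\le h\le1$ on $\mathbb{R}$, $h(0)=1$ and $\sum_{l\in L}|\alpha_l|^2|m_B((t-l)/R)|^2h((t-l)/R)=h(t)$ for all $t\in\mathbb{R}$ is the constant $1$, and therefore $$\left\{\Big(\prod_{i=0}^k\alpha_{l_i}\Big)e_{l_0+Rl_1+\dots+R^kl_k}: l_0\dots l_k\in\Omega(L)\right\}$$ is a Parseval frame for $L^2(\mu)$. Conversely, if there is a finite minimal invariant set $M\ne\{0\}$, then for every $c\in M$, $e_c$ is orthogonal in $L^2(\mu)$ to every element of this set (so the set is incomplete).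
   Context: $\tau_b(x)=(x+b)/R$; $\mu(R,B)$ is the unique Borel probability measure with $\mu(E)=\frac1N\sum_b\mu(\tau_b^{-1}(E))$, supported on the attractor $X_B=\bigcup_b\tau_b(X_B)$; no overlap means $\mu(\tau_b(X_B)\cap\tau_{b'}(X_B))=0$ for $b\ne b'$. $e_\lambda(x)=e^{2\pi i\lambda x}$, $m_B(x)=\frac1N\sum_{b\in B}e^{2\pi ibx}$, $g_l(t)=(t-l)/R$. A set $M\subset\mathbb{R}$ is invariant if for all $t\in M$ and $l\in L$ with $\alpha_lm_B(g_l(t))\ne0$ we have $g_l(t)\in M$; a finite minimal invariant set is a nonempty finite invariant set with no proper nonempty invariant subset. $\Omega(L)$: the empty word (giving $e_0$ with weight 1) and all words $l_0\dots l_k$ with $l_i\in L$, $l_k\ne0$. Parseval frame: $\sum_i|\langle v,f_i\rangle|^2=\|v\|^2$ for all $v$. *)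

theory Defs
  imports "HOL-Analysis.Analysis" "HOL-Probability.Probability"
begin

definition expo :: "real \<Rightarrow> real \<Rightarrow> complex" where
  "expo lam x = exp (2 * complex_of_real pi * \<i> * complex_of_real (lam * x))"

definition tau :: "int \<Rightarrow> int \<Rightarrow> real \<Rightarrow> real" where
  "tau R b x = (x + real_of_int b) / real_of_int R"

definition mB :: "int set \<Rightarrow> real \<Rightarrow> complex" where
  "mB B x = (1 / of_nat (card B)) * (\<Sum>b\<in>B. expo (real_of_int b) x)"

definition gl :: "int \<Rightarrow> int \<Rightarrow> real \<Rightarrow> real" where
  "gl R l t = (t - real_of_int l) / real_of_int R"

definition invariant_measure :: "int \<Rightarrow> int set \<Rightarrow> real measure \<Rightarrow> bool" where
  "invariant_measure R B \<mu> \<longleftrightarrow> prob_space \<mu> \<and> sets \<mu> = sets borel \<and>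
     (\<forall>E\<in>sets borel. measure \<mu> E =
        (1 / real (card B)) * (\<Sum>b\<in>B. measure \<mu> (tau R b -` E)))"

definition attractor :: "int \<Rightarrow> int set \<Rightarrow> real set \<Rightarrow> bool" where
  "attractor R B X \<longleftrightarrow> compact X \<and> X \<noteq> {} \<and> X = (\<Union>b\<in>B. tau R b ` X)"

definition no_overlap :: "int \<Rightarrow> int set \<Rightarrow> real measure \<Rightarrow> bool" where
  "no_overlap R B \<mu> \<longleftrightarrow> (\<forall>X. attractor R B X \<longrightarrow>
     (\<forall>b\<in>B. \<forall>b'\<in>B. b \<noteq> b' \<longrightarrow> measure \<mu> (tau R b ` X \<inter> tau R b' ` X) = 0))"

definition invariant_set :: "int \<Rightarrow> int set \<Rightarrow> int set \<Rightarrow> (int \<Rightarrow> complex) \<Rightarrow> real set \<Rightarrow> bool" where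
  "invariant_set R B L \<alpha> M \<longleftrightarrow> (\<forall>t\<in>M. \<forall>l\<in>L.
     \<alpha> l * mB B (gl R l t) \<noteq> 0 \<longrightarrow> gl R l t \<in> M)"

definition finite_minimal_invariant :: "int \<Rightarrow> int set \<Rightarrow> int set \<Rightarrow> (int \<Rightarrow> complex) \<Rightarrow> real set \<Rightarrow> bool" where
  "finite_minimal_invariant R B L \<alpha> M \<longleftrightarrow> finite M \<and> M \<noteq> {} \<and> invariant_set R B L \<alpha> M \<and>
     (\<forall>M'. M' \<subset> M \<and> M' \<noteq> {} \<longrightarrow> \<not> invariant_set R B L \<alpha> M')"

definition Omega :: "int set \<Rightarrow> int list set" where
  "Omega L = {w. set w \<subseteq> L \<and> (w = [] \<or> last w \<noteq> 0)}"

fun freq :: "int \<Rightarrow> int list \<Rightarrow> int" where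
  "freq R [] = 0"
| "freq R (l # ls) = l + R * freq R ls"

definition frame_elem :: "int \<Rightarrow> (int \<Rightarrow> complex) \<Rightarrow> int list \<Rightarrow> real \<Rightarrow> complex" where
  "frame_elem R \<alpha> w x = prod_list (map \<alpha> w) * expo (real_of_int (freq R w)) x"

definition L2 :: "real measure \<Rightarrow> (real \<Rightarrow> complex) set" where
  "L2 \<mu> = {f. f \<in> borel_measurable \<mu> \<and> integrable \<mu> (\<lambda>x. (cmod (f x))\<^sup>2)}"

definition L2_inner :: "real measure \<Rightarrow> (real \<Rightarrow> complex) \<Rightarrow> (real \<Rightarrow> complex) \<Rightarrow> complex" where
  "L2_inner \<mu> f g = (\<integral>x. f x * cnj (g x) \<partial>\<mu>)"

definition L2_normsq :: "real measure \<Rightarrow> (real \<Rightarrow> complex) \<Rightarrow> real" where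
  "L2_normsq \<mu> f = (\<integral>x. (cmod (f x))\<^sup>2 \<partial>\<mu>)"

definition parseval_frame :: "real measure \<Rightarrow> 'i set \<Rightarrow> ('i \<Rightarrow> real \<Rightarrow> complex) \<Rightarrow> bool" where
  "parseval_frame \<mu> I F \<longleftrightarrow> (\<forall>f\<in>L2 \<mu>.
     ((\<lambda>i. (cmod (L2_inner \<mu> f (F i)))\<^sup>2) has_sum L2_normsq \<mu> f) I)"

end

theory Submission
  imports Defs "HOL-Complex_Analysis.Complex_Analysis"
begin

text \<open>
  Let \<open>T l\<close> be the adjoint of \<open>f \<mapsto> \<alpha> l * e\<^sub>l * (f \<circ> \<sigma>)\<close>, where \<open>\<sigma> \<circ> tau R b = id\<close>. Orthonormality
  of the columns gives \<open>\<Sum>l. \<parallel>T l f\<parallel>\<^sup>2 = \<parallel>f\<parallel>\<^sup>2\<close>, and \<open>\<langle>f, f\<^bsub>l w\<^esub>\<rangle> = \<langle>T l f, f\<^bsub>w\<^esub>\<rangle>\<close>, so the system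
  satisfies the Bessel inequality. Since \<open>T l e\<^sub>t\<close> is a multiple of \<open>e\<^sub>s\<close> with \<open>s = g\<^sub>l(t)\<close>, the function
  \<open>h(t) = \<Sum>w. |\<langle>e\<^sub>t, f\<^bsub>w\<^esub>\<rangle>|\<^sup>2\<close> is a fixed point of the transfer operator; it extends to an entire
  function by Montel's theorem because the measure has compact support. The minimum set of an entire
  fixed point on a compact interval is invariant, hence infinite if \<open>{0}\<close> is the only finite minimal
  invariant set, and then \<open>h = 1\<close>. So Parseval's identity holds for all exponentials, and by the
  Bessel inequality it passes to their closed span, which is everything by Stone--Weierstrass.
\<close>

section \<open>Square-integrable functions\<close>

lemma cmod_add_squared_le: "(cmod (a + b))\<^sup>2 \<le> 2 * (cmod a)\<^sup>2 + 2 * (cmod b)\<^sup>2"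
proof -
  have "(cmod (a + b))\<^sup>2 \<le> (cmod a + cmod b)\<^sup>2"
    by (simp add: power_mono norm_triangle_ineq)
  also have "\<dots> \<le> 2 * (cmod a)\<^sup>2 + 2 * (cmod b)\<^sup>2"
    using sum_squares_bound[of "cmod a" "cmod b"] by (simp add: power2_sum)
  finally show ?thesis .
qed

lemma cmod_parallelogram: "(cmod (a + b))\<^sup>2 + (cmod (a - b))\<^sup>2 = 2 * (cmod a)\<^sup>2 + 2 * (cmod b)\<^sup>2"
  by (simp add: cmod_power2 power2_sum power2_diff)

lemma cnj_measurable [measurable]: "cnj \<in> borel_measurable borel"
  by (intro borel_measurable_continuous_onI continuous_intros)

lemma L2_measurable [measurable_dest]: "f \<in> L2 \<mu> \<Longrightarrow> f \<in> borel_measurable \<mu>"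
  by (simp add: L2_def)

lemma L2_integrable: "f \<in> L2 \<mu> \<Longrightarrow> integrable \<mu> (\<lambda>x. (cmod (f x))\<^sup>2)"
  by (simp add: L2_def)

lemma L2_add:
  assumes [measurable]: "f \<in> L2 \<mu>" "g \<in> L2 \<mu>"
  shows "(\<lambda>x. f x + g x) \<in> L2 \<mu>"
proof -
  have "integrable \<mu> (\<lambda>x. 2 * (cmod (f x))\<^sup>2 + 2 * (cmod (g x))\<^sup>2)"
    by (intro Bochner_Integration.integrable_add integrable_mult_right L2_integrable assms)
  then have "integrable \<mu> (\<lambda>x. (cmod (f x + g x))\<^sup>2)"
    by (rule Bochner_Integration.integrable_bound) (auto intro!: cmod_add_squared_le)
  then show ?thesis by (simp add: L2_def)
qed

lemma L2_scale:
  assumes [measurable]: "f \<in> L2 \<mu>"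
  shows "(\<lambda>x. c * f x) \<in> L2 \<mu>"
  using L2_integrable[OF assms] by (simp add: L2_def norm_mult power_mult_distrib)

lemma L2_diff:
  assumes "f \<in> L2 \<mu>" "g \<in> L2 \<mu>"
  shows "(\<lambda>x. f x - g x) \<in> L2 \<mu>"
  using L2_add[OF assms(1) L2_scale[OF assms(2), of "-1"]] by simp

lemma L2_sum:
  assumes "finite A" "\<And>i. i \<in> A \<Longrightarrow> f i \<in> L2 \<mu>"
  shows "(\<lambda>x. \<Sum>i\<in>A. f i x) \<in> L2 \<mu>"
  using assms
proof (induction A rule: finite_induct)
  case empty
  then show ?case by (simp add: L2_def)
next
  case (insert a A)
  then show ?case by (simp add: L2_add)
qed

lemma L2_bounded:
  assumes "finite_measure \<mu>" and [measurable]: "f \<in> borel_measurable \<mu>"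
    and "AE x in \<mu>. cmod (f x) \<le> C"
  shows "f \<in> L2 \<mu>"
proof -
  interpret finite_measure \<mu> by fact
  have "AE x in \<mu>. norm ((cmod (f x))\<^sup>2) \<le> C\<^sup>2"
    using assms(3) by eventually_elim (simp add: power_mono)
  then have "integrable \<mu> (\<lambda>x. (cmod (f x))\<^sup>2)"
    by (intro integrable_const_bound) auto
  then show ?thesis by (simp add: L2_def)
qed

lemma L2_inner_integrable:
  assumes [measurable]: "f \<in> L2 \<mu>" "g \<in> L2 \<mu>"
  shows "integrable \<mu> (\<lambda>x. f x * cnj (g x))"
proof -
  have "integrable \<mu> (\<lambda>x. (cmod (f x))\<^sup>2 + (cmod (g x))\<^sup>2)"
    by (intro Bochner_Integration.integrable_add L2_integrable assms)
  moreover have "cmod (f x) * cmod (g x) \<le> (cmod (f x))\<^sup>2 + (cmod (g x))\<^sup>2" for x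
    using sum_squares_bound[of "cmod (f x)" "cmod (g x)"]
      mult_nonneg_nonneg[OF norm_ge_zero[of "f x"] norm_ge_zero[of "g x"]] by linarith
  ultimately show ?thesis
    by (elim Bochner_Integration.integrable_bound) (auto simp: norm_mult)
qed

lemma L2_inner_add_left:
  assumes "f \<in> L2 \<mu>" "g \<in> L2 \<mu>" "k \<in> L2 \<mu>"
  shows "L2_inner \<mu> (\<lambda>x. f x + g x) k = L2_inner \<mu> f k + L2_inner \<mu> g k"
  using assms by (simp add: L2_inner_def ring_distribs L2_inner_integrable)

lemma L2_inner_diff_left:
  assumes "f \<in> L2 \<mu>" "g \<in> L2 \<mu>" "k \<in> L2 \<mu>"
  shows "L2_inner \<mu> (\<lambda>x. f x - g x) k = L2_inner \<mu> f k - L2_inner \<mu> g k"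
  using assms by (simp add: L2_inner_def left_diff_distrib L2_inner_integrable)

lemma L2_inner_scale_left: "L2_inner \<mu> (\<lambda>x. c * f x) k = c * L2_inner \<mu> f k"
  by (simp add: L2_inner_def mult.assoc)

lemma L2_normsq_nonneg: "0 \<le> L2_normsq \<mu> f"
  by (simp add: L2_normsq_def)

lemma L2_normsq_scale: "L2_normsq \<mu> (\<lambda>x. c * f x) = (cmod c)\<^sup>2 * L2_normsq \<mu> f"
  by (simp add: L2_normsq_def norm_mult power_mult_distrib)

lemma L2_normsq_parallelogram:
  assumes "f \<in> L2 \<mu>" "g \<in> L2 \<mu>"
  shows "L2_normsq \<mu> (\<lambda>x. f x + g x) + L2_normsq \<mu> (\<lambda>x. f x - g x)
    = 2 * L2_normsq \<mu> f + 2 * L2_normsq \<mu> g"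
proof -
  have "L2_normsq \<mu> (\<lambda>x. f x + g x) + L2_normsq \<mu> (\<lambda>x. f x - g x)
    = (\<integral>x. 2 * (cmod (f x))\<^sup>2 + 2 * (cmod (g x))\<^sup>2 \<partial>\<mu>)"
    unfolding L2_normsq_def cmod_parallelogram[symmetric]
    by (intro Bochner_Integration.integral_add[symmetric] L2_integrable L2_add L2_diff assms)
  then show ?thesis
    using assms by (simp add: L2_normsq_def L2_integrable)
qed

lemma L2_normsq_add_le:
  assumes "f \<in> L2 \<mu>" "g \<in> L2 \<mu>"
  shows "L2_normsq \<mu> (\<lambda>x. f x + g x) \<le> 2 * L2_normsq \<mu> f + 2 * L2_normsq \<mu> g"
  using L2_normsq_parallelogram[OF assms] L2_normsq_nonneg[of \<mu> "\<lambda>x. f x - g x"] by linarith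

text \<open>Dominated convergence for squared norms. It is the common limit step for closed sets,
  countable disjoint unions and simple functions.\<close>

lemma L2_normsq_diff_tendsto_0:
  assumes [measurable]: "f \<in> borel_measurable \<mu>" "\<And>n. s n \<in> borel_measurable \<mu>"
    and lim: "AE x in \<mu>. (\<lambda>n. s n x) \<longlonglongrightarrow> f x"
    and bound: "\<And>n. AE x in \<mu>. cmod (f x - s n x) \<le> k x"
    and k [measurable]: "k \<in> borel_measurable \<mu>" "integrable \<mu> (\<lambda>x. (k x)\<^sup>2)"
  shows "(\<lambda>n::nat. L2_normsq \<mu> (\<lambda>x. f x - s n x)) \<longlonglongrightarrow> 0"
proof -
  have "(\<lambda>n. \<integral>x. (cmod (f x - s n x))\<^sup>2 \<partial>\<mu>) \<longlonglongrightarrow> (\<integral>x. 0 \<partial>\<mu>)"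
  proof (rule integral_dominated_convergence)
    show "AE x in \<mu>. (\<lambda>n. (cmod (f x - s n x))\<^sup>2) \<longlonglongrightarrow> 0"
      using lim
    proof eventually_elim
      case (elim x)
      have "(\<lambda>n. (cmod (f x - s n x))\<^sup>2) \<longlonglongrightarrow> (cmod (f x - f x))\<^sup>2"
        by (intro tendsto_intros elim)
      then show ?case by simp
    qed
    show "AE x in \<mu>. norm ((cmod (f x - s n x))\<^sup>2) \<le> (k x)\<^sup>2" for n
      using bound[of n] by eventually_elim (simp add: power_mono)
  qed (use k(2) in auto)
  then show ?thesis by (simp add: L2_normsq_def)
qed

section \<open>Density of trigonometric polynomials\<close>

text \<open>Frequencies are arbitrary reals, so the exponentials separate the points of every
  interval. Induction along the constructors later carries Parseval's identity from exponentials to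
  their span.\<close>

inductive trig_poly :: "(real \<Rightarrow> complex) \<Rightarrow> bool" where
  trig_poly_expo: "trig_poly (expo t)"
| trig_poly_scale: "trig_poly p \<Longrightarrow> trig_poly (\<lambda>x. c * p x)"
| trig_poly_add: "trig_poly p \<Longrightarrow> trig_poly q \<Longrightarrow> trig_poly (\<lambda>x. p x + q x)"

lemma expo_0 [simp]: "expo 0 x = 1" "expo t 0 = 1"
  by (simp_all add: expo_def)

lemma expo_add: "expo (s + t) x = expo s x * expo t x"
  by (simp add: expo_def exp_add[symmetric] algebra_simps)

lemma expo_add_arg: "expo t (x + y) = expo t x * expo t y"
  by (simp add: expo_def exp_add[symmetric] algebra_simps)

lemma cnj_expo: "cnj (expo t x) = expo (- t) x"
  by (simp add: expo_def exp_cnj)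

lemma norm_expo [simp]: "cmod (expo t x) = 1"
  by (simp add: expo_def)

lemma continuous_on_expo [continuous_intros]: "continuous_on S (expo t)"
  unfolding expo_def by (intro continuous_intros)

lemma expo_measurable [measurable]: "expo t \<in> borel_measurable borel"
  by (intro borel_measurable_continuous_onI continuous_intros)

lemma trig_poly_const: "trig_poly (\<lambda>_. c)"
  using trig_poly_scale[OF trig_poly_expo[of 0], of c] by simp

lemma trig_poly_mult: "trig_poly p \<Longrightarrow> trig_poly q \<Longrightarrow> trig_poly (\<lambda>x. p x * q x)"
proof (induction rule: trig_poly.induct)
  case (trig_poly_expo t)
  then show ?case
  proof (induction rule: trig_poly.induct)
    case (trig_poly_expo s)
    have "(\<lambda>x. expo t x * expo s x) = expo (t + s)" by (simp add: expo_add fun_eq_iff)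
    then show ?case using trig_poly.trig_poly_expo by metis
  next
    case (trig_poly_scale p c)
    then show ?case using trig_poly.trig_poly_scale[of "\<lambda>x. expo t x * p x" c]
      by (simp add: mult.left_commute)
  next
    case (trig_poly_add p q)
    then show ?case by (simp add: ring_distribs trig_poly.trig_poly_add)
  qed
next
  case (trig_poly_scale p c)
  then show ?case using trig_poly.trig_poly_scale[of "\<lambda>x. p x * q x" c]
    by (simp add: mult.assoc)
next
  case (trig_poly_add p q)
  then show ?case by (simp add: ring_distribs trig_poly.trig_poly_add)
qed

lemma trig_poly_continuous: "trig_poly p \<Longrightarrow> continuous_on S p"
  by (induction rule: trig_poly.induct) (auto intro: continuous_intros)

lemma trig_poly_measurable: "trig_poly p \<Longrightarrow> p \<in> borel_measurable borel"
  by (intro borel_measurable_continuous_onI trig_poly_continuous)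

lemma trig_poly_bounded: "trig_poly p \<Longrightarrow> \<exists>C. \<forall>x. cmod (p x) \<le> C"
proof (induction rule: trig_poly.induct)
  case (trig_poly_scale p c)
  then obtain C where "\<forall>x. cmod (p x) \<le> C" by blast
  then have "\<forall>x. cmod (c * p x) \<le> cmod c * C" by (simp add: norm_mult mult_left_mono)
  then show ?case by blast
next
  case (trig_poly_add p q)
  then obtain C C' where "\<forall>x. cmod (p x) \<le> C" "\<forall>x. cmod (q x) \<le> C'" by blast
  then have "\<forall>x. cmod (p x + q x) \<le> C + C'" by (simp add: norm_add_rule_thm)
  then show ?case by blast
qed auto

lemma trig_poly_L2:
  assumes "finite_measure \<mu>" "sets \<mu> = sets borel" "trig_poly p"
  shows "p \<in> L2 \<mu>"
proof -
  obtain C where "\<forall>x. cmod (p x) \<le> C" using trig_poly_bounded[OF assms(3)] by blast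
  moreover have "p \<in> borel_measurable \<mu>"
    using trig_poly_measurable[OF assms(3)] by (simp add: measurable_cong_sets[OF assms(2) refl])
  ultimately show ?thesis using assms(1) by (intro L2_bounded) auto
qed

text \<open>Stone-Weierstrass applied to the real algebra of those real functions whose
  complexification is a trigonometric polynomial. Sine waves separate points.\<close>

lemma trig_poly_uniform_dense:
  fixes u :: "real \<Rightarrow> real"
  assumes "continuous_on {-r..r} u" "e > 0"
  obtains p where "trig_poly p" "\<And>x. x \<in> {-r..r} \<Longrightarrow> cmod (complex_of_real (u x) - p x) < e"
proof -
  let ?P = "\<lambda>f. trig_poly (\<lambda>x::real. complex_of_real (f x))"
  have "\<exists>g. ?P g \<and> (\<forall>x\<in>{-r..r}. \<bar>u x - g x\<bar> < e)"
  proof (rule Stone_Weierstrass_HOL)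
    show "?P (\<lambda>x. c)" for c by (rule trig_poly_const)
    show "continuous_on {-r..r} f" if "?P f" for f
    proof -
      have "continuous_on {-r..r} (\<lambda>x. Re (complex_of_real (f x)))"
        by (intro continuous_intros trig_poly_continuous that)
      then show ?thesis by simp
    qed
    show "?P (\<lambda>x. f x + g x)" if "?P f \<and> ?P g" for f g
      using that trig_poly_add[of "\<lambda>x. complex_of_real (f x)" "\<lambda>x. complex_of_real (g x)"] by simp
    show "?P (\<lambda>x. f x * g x)" if "?P f \<and> ?P g" for f g
      using that trig_poly_mult[of "\<lambda>x. complex_of_real (f x)" "\<lambda>x. complex_of_real (g x)"] by simp
    show "\<exists>f. ?P f \<and> f x \<noteq> f y" if "x \<in> {-r..r} \<and> y \<in> {-r..r} \<and> x \<noteq> y" for x y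
    proof -
      \<comment> \<open>This frequency puts \<open>x\<close> a quarter period away from
        \<open>y\<close>, so the sine below is 1 at \<open>x\<close> and 0 at
        \<open>y\<close>.\<close>
      define t where "t = 1 / (4 * (x - y))"
      have xy: "x \<noteq> y" using that by simp
      define f where "f = (\<lambda>z. sin (2 * pi * t * (z - y)))"
      have "complex_of_real (f z) = (-\<i>/2 * expo t (-y)) * expo t z + (\<i>/2 * expo (-t) (-y)) * expo (-t) z" for z
      proof -
        have "complex_of_real (f z) = sin (complex_of_real (2 * pi * t * (z - y)))"
          unfolding f_def by (rule sin_of_real[symmetric])
        also have "\<dots> = -\<i>/2 * expo t (z + (-y)) + \<i>/2 * expo (-t) (z + (-y))"
          by (simp add: sin_exp_eq expo_def field_simps)
        finally show ?thesis unfolding expo_add_arg by (simp add: algebra_simps)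
      qed
      then have "(\<lambda>z. complex_of_real (f z)) =
         (\<lambda>z. (-\<i>/2 * expo t (-y)) * expo t z + (\<i>/2 * expo (-t) (-y)) * expo (-t) z)" by blast
      then have "?P f"
        using trig_poly_add[OF trig_poly_scale[OF trig_poly_expo] trig_poly_scale[OF trig_poly_expo]]
        by metis
      moreover have "2 * pi * t * (x - y) = pi / 2"
        using xy by (simp add: t_def divide_simps)
      then have "f x = 1" unfolding f_def by (metis sin_pi_half)
      moreover have "f y = 0" by (simp add: f_def)
      ultimately show ?thesis by (intro exI[of _ f]) simp
    qed
  qed (use assms in auto)
  then obtain g where g: "?P g" "\<forall>x\<in>{-r..r}. \<bar>u x - g x\<bar> < e" by blast
  have "cmod (complex_of_real (u x) - complex_of_real (g x)) < e" if "x \<in> {-r..r}" for x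
    using g(2) that by (metis norm_of_real of_real_diff)
  with g(1) show ?thesis by (rule that)
qed

section \<open>The closure of the trigonometric polynomials in the square-integrable
  functions\<close>

definition trig_approximable :: "real measure \<Rightarrow> (real \<Rightarrow> complex) \<Rightarrow> bool" where
  "trig_approximable \<mu> f \<longleftrightarrow> f \<in> L2 \<mu> \<and>
     (\<forall>e>0. \<exists>p. trig_poly p \<and> L2_normsq \<mu> (\<lambda>x. f x - p x) < e)"

locale compactly_supported_measure = finite_measure \<mu> for \<mu> :: "real measure" +
  fixes r :: real
  assumes sets_borel [measurable_cong]: "sets \<mu> = sets borel"
    and support: "AE x in \<mu>. \<bar>x\<bar> \<le> r"
begin

lemma space_UNIV [simp]: "space \<mu> = UNIV"
  using sets_eq_imp_space_eq[OF sets_borel] by simp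

lemma trig_poly_in_L2: "trig_poly p \<Longrightarrow> p \<in> L2 \<mu>"
  using trig_poly_L2 finite_measure_axioms sets_borel by blast

lemma trig_approximable_closed:
  assumes f: "f \<in> L2 \<mu>"
    and g: "\<And>e. e > 0 \<Longrightarrow> \<exists>g. trig_approximable \<mu> g \<and> L2_normsq \<mu> (\<lambda>x. f x - g x) < e"
  shows "trig_approximable \<mu> f"
  unfolding trig_approximable_def
proof (intro conjI allI impI f)
  fix e :: real assume e: "e > 0"
  obtain g where g: "trig_approximable \<mu> g" "L2_normsq \<mu> (\<lambda>x. f x - g x) < e / 4"
    using g[of "e/4"] e by auto
  then obtain p where p: "trig_poly p" "L2_normsq \<mu> (\<lambda>x. g x - p x) < e / 4" and gL: "g \<in> L2 \<mu>"
    unfolding trig_approximable_def using e by (metis divide_pos_pos zero_less_numeral)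
  have "L2_normsq \<mu> (\<lambda>x. f x - p x) = L2_normsq \<mu> (\<lambda>x. (f x - g x) + (g x - p x))" by simp
  also have "\<dots> \<le> 2 * L2_normsq \<mu> (\<lambda>x. f x - g x) + 2 * L2_normsq \<mu> (\<lambda>x. g x - p x)"
    by (intro L2_normsq_add_le L2_diff f gL trig_poly_in_L2 p)
  also have "\<dots> < e" using g(2) p(2) by simp
  finally show "\<exists>p. trig_poly p \<and> L2_normsq \<mu> (\<lambda>x. f x - p x) < e" using p(1) by blast
qed

lemma trig_approximable_tendsto:
  assumes "f \<in> L2 \<mu>" "\<And>n. trig_approximable \<mu> (s n)"
    and lim: "(\<lambda>n::nat. L2_normsq \<mu> (\<lambda>x. f x - s n x)) \<longlonglongrightarrow> 0"
  shows "trig_approximable \<mu> f"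
proof (rule trig_approximable_closed)
  fix e :: real assume "e > 0"
  then have "\<forall>\<^sub>F n in sequentially. L2_normsq \<mu> (\<lambda>x. f x - s n x) < e"
    by (rule order_tendstoD(2)[OF lim])
  then show "\<exists>g. trig_approximable \<mu> g \<and> L2_normsq \<mu> (\<lambda>x. f x - g x) < e"
    using assms(2) by (meson eventually_happens' sequentially_bot)
qed fact

lemma trig_approximable_scale:
  assumes "trig_approximable \<mu> f"
  shows "trig_approximable \<mu> (\<lambda>x. c * f x)"
  unfolding trig_approximable_def
proof (intro conjI allI impI)
  show "(\<lambda>x. c * f x) \<in> L2 \<mu>" using assms by (simp add: trig_approximable_def L2_scale)
  fix e :: real assume e: "e > 0"
  define k where "k = (cmod c)\<^sup>2 + 1"
  have k: "k > 0" by (simp add: k_def add_nonneg_pos)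
  obtain p where p: "trig_poly p" "L2_normsq \<mu> (\<lambda>x. f x - p x) < e / k"
    using assms e k unfolding trig_approximable_def by (metis divide_pos_pos)
  have "L2_normsq \<mu> (\<lambda>x. c * f x - c * p x) = (cmod c)\<^sup>2 * L2_normsq \<mu> (\<lambda>x. f x - p x)"
    by (simp add: L2_normsq_scale[symmetric] right_diff_distrib)
  also have "\<dots> \<le> k * L2_normsq \<mu> (\<lambda>x. f x - p x)"
    by (intro mult_right_mono L2_normsq_nonneg) (simp add: k_def)
  also have "\<dots> < e" using p(2) k by (simp add: field_simps)
  finally show "\<exists>q. trig_poly q \<and> L2_normsq \<mu> (\<lambda>x. c * f x - q x) < e"
    using trig_poly_scale[OF p(1)] by blast
qed

lemma trig_approximable_add:
  assumes f: "trig_approximable \<mu> f" and g: "trig_approximable \<mu> g"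
  shows "trig_approximable \<mu> (\<lambda>x. f x + g x)"
  unfolding trig_approximable_def
proof (intro conjI allI impI)
  have L: "f \<in> L2 \<mu>" "g \<in> L2 \<mu>" using f g by (simp_all add: trig_approximable_def)
  then show "(\<lambda>x. f x + g x) \<in> L2 \<mu>" by (rule L2_add)
  fix e :: real assume e: "e > 0"
  obtain p where p: "trig_poly p" "L2_normsq \<mu> (\<lambda>x. f x - p x) < e / 4"
    using f e unfolding trig_approximable_def by (metis divide_pos_pos zero_less_numeral)
  obtain q where q: "trig_poly q" "L2_normsq \<mu> (\<lambda>x. g x - q x) < e / 4"
    using g e unfolding trig_approximable_def by (metis divide_pos_pos zero_less_numeral)
  have "L2_normsq \<mu> (\<lambda>x. f x + g x - (p x + q x))
      = L2_normsq \<mu> (\<lambda>x. (f x - p x) + (g x - q x))" by (simp add: algebra_simps)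
  also have "\<dots> \<le> 2 * L2_normsq \<mu> (\<lambda>x. f x - p x) + 2 * L2_normsq \<mu> (\<lambda>x. g x - q x)"
    by (intro L2_normsq_add_le L2_diff L trig_poly_in_L2 p q)
  also have "\<dots> < e" using q(2) p(2) by simp
  finally show "\<exists>p. trig_poly p \<and> L2_normsq \<mu> (\<lambda>x. f x + g x - p x) < e"
    using trig_poly_add[OF p(1) q(1)] by blast
qed

lemma trig_approximable_trig_poly:
  assumes "trig_poly p"
  shows "trig_approximable \<mu> p"
proof -
  have "\<exists>q. trig_poly q \<and> L2_normsq \<mu> (\<lambda>x. p x - q x) < e" if "e > 0" for e
    using assms that by (intro exI[of _ p]) (simp add: L2_normsq_def)
  then show ?thesis using assms by (simp add: trig_approximable_def trig_poly_in_L2)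
qed

lemma trig_approximable_sum:
  assumes "finite A" "\<And>i. i \<in> A \<Longrightarrow> trig_approximable \<mu> (f i)"
  shows "trig_approximable \<mu> (\<lambda>x. \<Sum>i\<in>A. f i x)"
  using assms
  by (induction A rule: finite_induct)
    (auto intro: trig_approximable_add trig_approximable_trig_poly trig_poly_const)

text \<open>Uniform closeness is available only on \<open>{-r..r}\<close>, which is enough because
  the complement is a null set.\<close>

lemma trig_approximable_continuous:
  fixes u :: "real \<Rightarrow> real"
  assumes u: "continuous_on UNIV u" and bounded: "\<And>x. \<bar>u x\<bar> \<le> C"
  shows "trig_approximable \<mu> (\<lambda>x. complex_of_real (u x))"
  unfolding trig_approximable_def
proof (intro conjI allI impI)
  have [measurable]: "u \<in> borel_measurable borel" using u by (rule borel_measurable_continuous_onI)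
  have "complex_of_real \<circ> u \<in> borel_measurable \<mu>" by measurable
  then have u_meas: "(\<lambda>x. complex_of_real (u x)) \<in> borel_measurable \<mu>" by (simp add: comp_def)
  then show uL: "(\<lambda>x. complex_of_real (u x)) \<in> L2 \<mu>"
    using bounded by (intro L2_bounded finite_measure_axioms) auto
  fix e :: real assume e: "e > 0"
  \<comment> \<open>Adding 1 keeps \<open>k\<close> positive for the zero measure and makes the
    final inequality strict.\<close>
  define k where "k = measure \<mu> UNIV + 1"
  have k: "k > 0" by (simp add: k_def add_nonneg_pos)
  define d where "d = sqrt (e / k)"
  have d: "d > 0" "d\<^sup>2 * k = e" using e k by (simp_all add: d_def)
  obtain p where p: "trig_poly p" "\<And>x. x \<in> {-r..r} \<Longrightarrow> cmod (complex_of_real (u x) - p x) < d"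
    using trig_poly_uniform_dense[OF continuous_on_subset[OF u] d(1), of r] by auto
  have "L2_normsq \<mu> (\<lambda>x. complex_of_real (u x) - p x) \<le> (\<integral>x. d\<^sup>2 \<partial>\<mu>)"
    unfolding L2_normsq_def
  proof (rule integral_mono_AE)
    show "integrable \<mu> (\<lambda>x. (cmod (complex_of_real (u x) - p x))\<^sup>2)"
      by (intro L2_integrable L2_diff uL trig_poly_in_L2 p)
    show "AE x in \<mu>. (cmod (complex_of_real (u x) - p x))\<^sup>2 \<le> d\<^sup>2"
      using support
    proof eventually_elim
      case (elim x)
      then have "x \<in> {-r..r}" by (auto simp: abs_le_iff)
      from p(2)[OF this] show ?case by (intro power_mono) auto
    qed
  qed simp
  also have "\<dots> < d\<^sup>2 * k" using d(1) by (simp add: k_def mult.commute)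
  finally show "\<exists>p. trig_poly p \<and> L2_normsq \<mu> (\<lambda>x. complex_of_real (u x) - p x) < e"
    using p(1) d(2) by auto
qed

text \<open>Continuous cutoffs built from the distance to \<open>C\<close> decrease to its
  indicator, since points outside a closed set have positive distance. The empty set is excluded
  because \<open>infdist\<close> to it is 0 by convention.\<close>

lemma trig_approximable_indicator_closed:
  assumes C: "closed C" "C \<noteq> {}"
  shows "trig_approximable \<mu> (indicator C)"
proof (rule trig_approximable_tendsto)
  define s :: "nat \<Rightarrow> real \<Rightarrow> real" where "s n x = max 0 (1 - real n * infdist x C)" for n x
  have s01: "0 \<le> s n x" "s n x \<le> 1" for n x by (auto simp: s_def infdist_nonneg)
  have s_cont: "continuous_on UNIV (s n)" for n
    unfolding s_def by (intro continuous_intros)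
  then have [measurable]: "s n \<in> borel_measurable borel" for n
    by (rule borel_measurable_continuous_onI)
  have [measurable]: "C \<in> sets borel" using C(1) by simp
  show "indicator C \<in> L2 \<mu>"
    by (rule L2_bounded[where C = 1]) (auto simp: finite_measure_axioms indicator_def)
  show "trig_approximable \<mu> (\<lambda>x. complex_of_real (s n x))" for n
    using s01 by (intro trig_approximable_continuous[where C = 1] s_cont) auto
  have lim: "(\<lambda>n. complex_of_real (s n x)) \<longlonglongrightarrow> indicator C x" for x
  proof (cases "x \<in> C")
    case True
    then show ?thesis by (simp add: s_def)
  next
    case False
    then have pos: "infdist x C > 0"
      using C in_closed_iff_infdist_zero[of C x] infdist_nonneg[of x C] by force
    obtain m :: nat where m: "1 / infdist x C < m" using reals_Archimedean2 by blast
    have "s n x = 0" if "n \<ge> m" for n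
    proof -
      have "1 / infdist x C < n" using m that by (meson less_le_trans of_nat_le_iff)
      then show ?thesis using pos by (simp add: s_def field_simps)
    qed
    then have "\<forall>\<^sub>F n in sequentially. complex_of_real (s n x) = indicator C x"
      using False by (auto simp: eventually_sequentially)
    then show ?thesis by (rule tendsto_eventually)
  qed
  have bound: "cmod (indicator C x - complex_of_real (s n x)) \<le> 1" for n x
  proof (cases "x \<in> C")
    case True
    then show ?thesis by (simp add: s_def)
  qed (use s01[of n x] in auto)
  show "(\<lambda>n. L2_normsq \<mu> (\<lambda>x. indicator C x - complex_of_real (s n x))) \<longlonglongrightarrow> 0"
    by (rule L2_normsq_diff_tendsto_0[where k = "\<lambda>_. 1"]) (use lim bound in \<open>auto\<close>)
qed

text \<open>Dynkin's argument: closed sets are stable under intersection and generate the Borel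
  sets, and approximability survives complements and countable disjoint unions.\<close>

lemma trig_approximable_indicator:
  assumes "A \<in> sets borel"
  shows "trig_approximable \<mu> (indicator A)"
proof -
  have zero: "trig_approximable \<mu> (\<lambda>x. 0)" by (rule trig_approximable_trig_poly[OF trig_poly_const])
  have ind_L2: "indicator A \<in> L2 \<mu>" if "A \<in> sets borel" for A :: "real set"
    using that by (intro L2_bounded[where C = 1]) (auto simp: finite_measure_axioms indicator_def sets_borel)
  have "Int_stable (Collect closed :: real set set)" by (auto simp: Int_stable_def)
  moreover have "Collect closed \<subseteq> Pow (UNIV :: real set)" by simp
  moreover have "A \<in> sigma_sets UNIV (Collect closed)"
    using assms by (simp add: borel_eq_closed)
  ultimately show ?thesis
  proof (induction rule: sigma_sets_induct_disjoint)
    case (basic A)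
    then show ?case
    proof (cases "A = {}")
      case True
      then show ?thesis using zero by (simp add: indicator_def[abs_def])
    qed (simp add: trig_approximable_indicator_closed)
  next
    case empty
    then show ?case using zero by (simp add: indicator_def[abs_def])
  next
    case (compl A)
    have "indicator (UNIV - A) = (\<lambda>x. 1 + (-1) * indicator A x :: complex)"
      by (auto simp: indicator_def)
    then show ?case
      using trig_approximable_add[OF trig_approximable_trig_poly[OF trig_poly_const]
          trig_approximable_scale[OF compl(2)], of 1 "-1"] by simp
  next
    case (union A)
    have A: "A i \<in> sets borel" for i using union(2) by (auto simp: borel_eq_closed)
    have U: "(\<Union>i. A i) \<in> sets borel" using A by blast
    define s where "s n x = (\<Sum>i<n. indicator (A i) x :: complex)" for n :: nat and x
    have s: "s n = indicator (\<Union>i<n. A i)" for n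
    proof
      fix x
      have "disjoint_family_on A {..<n}"
        using union(1) by (auto simp: disjoint_family_on_def)
      then show "s n x = indicator (\<Union>i<n. A i) x"
        by (simp add: s_def indicator_UN_disjoint)
    qed
    have sm [measurable]: "s n \<in> borel_measurable \<mu>" for n
      unfolding s using A by (simp add: sets_borel)
    show ?case
    proof (rule trig_approximable_tendsto)
      show "indicator (\<Union>i. A i) \<in> L2 \<mu>" by (rule ind_L2[OF U])
      show "trig_approximable \<mu> (s n)" for n
        unfolding s_def using union(3) by (intro trig_approximable_sum) auto
      have lim: "(\<lambda>n. s n x) \<longlonglongrightarrow> indicator (\<Union>i. A i) x" for x
        unfolding s by (rule LIMSEQ_indicator_UN)
      show "(\<lambda>n. L2_normsq \<mu> (\<lambda>x. indicator (\<Union>i. A i) x - s n x)) \<longlonglongrightarrow> 0"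
      proof (rule L2_normsq_diff_tendsto_0[where k = "\<lambda>_. 1"])
        show "AE x in \<mu>. cmod (indicator (\<Union>i. A i) x - s n x) \<le> 1" for n
          unfolding s by (auto simp: indicator_def)
      qed (use lim U in \<open>auto simp: sets_borel\<close>)
    qed
  qed
qed

text \<open>Simple functions converge to \<open>f\<close> pointwise and are bounded by
  \<open>2 * cmod (f x)\<close>, so the differences are dominated by three times the modulus of
  \<open>f\<close>. Each simple function is a finite combination of indicators.\<close>

theorem trig_poly_dense:
  assumes f: "f \<in> L2 \<mu>"
  shows "trig_approximable \<mu> f"
proof -
  from borel_measurable_implies_sequence_metric[OF L2_measurable[OF f], of 0]
  obtain s where s: "\<And>i. simple_function \<mu> (s i)" "\<And>x. (\<lambda>i. s i x) \<longlonglongrightarrow> f x"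
    "\<And>i x. cmod (s i x) \<le> 2 * cmod (f x)"
    by (auto simp: dist_norm)
  have sm [measurable]: "s i \<in> borel_measurable \<mu>" for i
    using s(1) by (rule borel_measurable_simple_function)
  have approx: "trig_approximable \<mu> (s i)" for i
  proof -
    have "s i = (\<lambda>x. \<Sum>y\<in>range (s i). y * indicator (s i -` {y}) x)"
    proof
      fix x
      have fin: "finite (range (s i))" using simple_functionD(1)[OF s(1)] by simp
      have "(\<Sum>y\<in>range (s i). y * indicator (s i -` {y}) x) = (\<Sum>y\<in>range (s i). if y = s i x then y else 0)"
        by (rule sum.cong) (auto simp: indicator_def)
      also have "\<dots> = s i x" using fin by simp
      finally show "s i x = (\<Sum>y\<in>range (s i). y * indicator (s i -` {y}) x)" by simp
    qed
    moreover have "trig_approximable \<mu> (\<lambda>x. \<Sum>y\<in>range (s i). y * indicator (s i -` {y}) x)"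
    proof (intro trig_approximable_sum trig_approximable_scale trig_approximable_indicator)
      show "finite (range (s i))" using simple_functionD(1)[OF s(1)] by simp
      show "s i -` {y} \<in> sets borel" for y
        using simple_functionD(2)[OF s(1), of i "{y}"] by (simp add: sets_borel)
    qed
    ultimately show ?thesis by simp
  qed
  have [measurable]: "f \<in> borel_measurable \<mu>" using f by (rule L2_measurable)
  show ?thesis
  proof (rule trig_approximable_tendsto[OF f approx])
    show "(\<lambda>n. L2_normsq \<mu> (\<lambda>x. f x - s n x)) \<longlonglongrightarrow> 0"
    proof (rule L2_normsq_diff_tendsto_0[where k = "\<lambda>x. 3 * cmod (f x)"])
      show "AE x in \<mu>. cmod (f x - s n x) \<le> 3 * cmod (f x)" for n
      proof (rule AE_I2)
        fix x
        show "cmod (f x - s n x) \<le> 3 * cmod (f x)"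
          using norm_triangle_ineq4[of "f x" "s n x"] s(3)[of n x] by linarith
      qed
      show "integrable \<mu> (\<lambda>x. (3 * cmod (f x))\<^sup>2)"
        using L2_integrable[OF f] by (simp add: power_mult_distrib)
    qed (use s(2) in auto)
  qed
qed

end

section \<open>The measure and the operators of the iterated function system\<close>

locale ifs_measure =
  fixes R :: int and B :: "int set" and \<mu> :: "real measure"
  assumes R: "\<bar>R\<bar> \<ge> 2"
    and B: "finite B" "0 \<in> B"
    and mu: "invariant_measure R B \<mu>"
begin

lemma R_nz: "real_of_int R \<noteq> 0"
  using R by auto

lemma abs_R_ge: "\<bar>real_of_int R\<bar> \<ge> 2"
  using R by linarith

lemma card_B: "card B > 0"
  using B card_gt_0_iff by blast

sublocale prob_space \<mu>
  using mu by (simp add: invariant_measure_def)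

lemma sets_mu [measurable_cong]: "sets \<mu> = sets borel"
  using mu by (simp add: invariant_measure_def)

lemma space_mu [simp]: "space \<mu> = UNIV"
  using sets_eq_imp_space_eq[OF sets_mu] by simp

lemma measure_mu: "E \<in> sets borel \<Longrightarrow>
    measure \<mu> E = (1 / real (card B)) * (\<Sum>b\<in>B. measure \<mu> (tau R b -` E))"
  using mu by (simp add: invariant_measure_def)

lemma tau_measurable [measurable]: "tau R b \<in> borel_measurable borel"
  unfolding tau_def by measurable

section \<open>Boundedness of the support\<close>

definition digit_bound :: real where
  "digit_bound = real_of_int (Max (abs ` B))"

lemma digit_bound: "b \<in> B \<Longrightarrow> \<bar>real_of_int b\<bar> \<le> digit_bound"
proof -
  assume "b \<in> B"
  then have "\<bar>b\<bar> \<le> Max (abs ` B)" using B(1) by (intro Max_ge) auto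
  then show ?thesis unfolding digit_bound_def by linarith
qed

lemma digit_bound_nonneg: "0 \<le> digit_bound"
  using digit_bound[OF B(2)] by simp

text \<open>The branches contract by at least 2: if \<open>tau R b x\<close> is further than
  \<open>digit_bound + s\<close> from 0, then \<open>x\<close> is further than
  \<open>2 * (digit_bound + s) - digit_bound\<close>. Invariance averages this over the
  digits.\<close>

lemma measure_tail_le:
  assumes s: "s \<ge> 0"
  shows "measure \<mu> {x. \<bar>x\<bar> > digit_bound + s} \<le> measure \<mu> {x. \<bar>x\<bar> > digit_bound + 2 * s}"
proof -
  let ?E = "\<lambda>s. {x::real. \<bar>x\<bar> > digit_bound + s}"
  have E: "?E s \<in> sets borel" for s by measurable
  have "measure \<mu> (tau R b -` ?E s) \<le> measure \<mu> (?E (2 * s))" if b: "b \<in> B" for b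
  proof (rule finite_measure_mono)
    show "tau R b -` ?E s \<subseteq> ?E (2 * s)"
    proof
      fix x assume "x \<in> tau R b -` ?E s"
      then have "digit_bound + s < \<bar>x + real_of_int b\<bar> / \<bar>real_of_int R\<bar>"
        by (simp add: tau_def abs_divide)
      then have "(digit_bound + s) * \<bar>real_of_int R\<bar> < \<bar>x + real_of_int b\<bar>"
        using R_nz by (simp add: pos_less_divide_eq)
      moreover have "(digit_bound + s) * 2 \<le> (digit_bound + s) * \<bar>real_of_int R\<bar>"
        using abs_R_ge digit_bound_nonneg s by (intro mult_left_mono) auto
      ultimately show "x \<in> ?E (2 * s)" using digit_bound[OF b] by simp
    qed
  qed (simp add: sets_mu E)
  then have "(\<Sum>b\<in>B. measure \<mu> (tau R b -` ?E s)) \<le> real (card B) * measure \<mu> (?E (2 * s))"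
    by (rule sum_bounded_above)
  then show ?thesis
    unfolding measure_mu[OF E] using card_B by (simp add: field_simps measure_mu[OF E, symmetric])
qed

text \<open>Iterating the doubling bounds the tail by tails escaping to infinity, whose mass tends
  to 0 because the measure is finite.\<close>

lemma measure_tail_eq_0:
  assumes s: "s > 0"
  shows "measure \<mu> {x. \<bar>x\<bar> > digit_bound + s} = 0"
proof -
  let ?E = "\<lambda>s. {x::real. \<bar>x\<bar> > digit_bound + s}"
  have E: "?E s \<in> sets borel" for s by measurable
  have le: "measure \<mu> (?E s) \<le> measure \<mu> (?E (2 ^ n * s))" for n
  proof (induction n)
    case (Suc n)
    note Suc
    also have "measure \<mu> (?E (2 ^ n * s)) \<le> measure \<mu> (?E (2 * (2 ^ n * s)))"
      using s by (intro measure_tail_le) simp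
    finally show ?case by (simp add: mult.assoc)
  qed simp
  have "(\<lambda>n. measure \<mu> (?E (2 ^ n * s))) \<longlonglongrightarrow> measure \<mu> (\<Inter>n. ?E (2 ^ n * s))"
  proof (rule finite_Lim_measure_decseq)
    show "range (\<lambda>n. ?E (2 ^ n * s)) \<subseteq> sets \<mu>"
      unfolding sets_mu using E by blast
    show "decseq (\<lambda>n. ?E (2 ^ n * s))"
    proof (rule decseq_SucI)
      fix n :: nat
      have "2 ^ n * s \<le> 2 ^ Suc n * s" using s by simp
      then show "?E (2 ^ Suc n * s) \<subseteq> ?E (2 ^ n * s)"
        by (intro Collect_mono impI) linarith
    qed
  qed
  moreover have "(\<Inter>n. ?E (2 ^ n * s)) = {}"
  proof -
    have "\<exists>n. \<not> \<bar>x\<bar> > digit_bound + 2 ^ n * s" for x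
    proof -
      obtain n where "\<bar>x\<bar> / s < 2 ^ n" using real_arch_pow[of 2 "\<bar>x\<bar> / s"] by auto
      then have "\<bar>x\<bar> < 2 ^ n * s" using s by (simp add: field_simps)
      then show ?thesis using digit_bound_nonneg by (intro exI[of _ n]) simp
    qed
    then show ?thesis by auto
  qed
  ultimately have "(\<lambda>n. measure \<mu> (?E (2 ^ n * s))) \<longlonglongrightarrow> 0" by simp
  then have "measure \<mu> (?E s) \<le> 0"
    by (rule LIMSEQ_le_const) (use le in auto)
  then show ?thesis using measure_nonneg[of \<mu> "?E s"] by linarith
qed

sublocale compactly_supported_measure \<mu> "digit_bound + 1"
proof
  show "sets \<mu> = sets borel" by (rule sets_mu)
  have "{x::real. \<bar>x\<bar> > digit_bound + 1} \<in> sets borel" by measurable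
  then have "{x::real. \<bar>x\<bar> > digit_bound + 1} \<in> null_sets \<mu>"
    using measure_tail_eq_0[of 1] by (simp add: null_sets_def emeasure_eq_measure sets_mu)
  then show "AE x in \<mu>. \<bar>x\<bar> \<le> digit_bound + 1"
    by (rule AE_I') auto
qed

section \<open>Self-similarity of integrals\<close>

lemma nn_integral_mu:
  assumes "f \<in> borel_measurable borel"
  shows "(\<integral>\<^sup>+x. f x \<partial>\<mu>) = (\<Sum>b\<in>B. ennreal (1 / real (card B)) * (\<integral>\<^sup>+x. f (tau R b x) \<partial>\<mu>))"
  using assms
proof (induction rule: borel_measurable_induct)
  case (cong f g)
  then show ?case by simp
next
  case (set A)
  have "(\<integral>\<^sup>+x. indicator A (tau R b x) \<partial>\<mu>) = ennreal (measure \<mu> (tau R b -` A))" for b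
  proof -
    have "tau R b -` A \<in> sets borel"
      using measurable_sets[OF tau_measurable set, of b] by simp
    moreover have "(\<lambda>x. indicator A (tau R b x) :: ennreal) = indicator (tau R b -` A)"
      by (auto simp: indicator_def)
    ultimately show ?thesis by (simp add: sets_mu emeasure_eq_measure)
  qed
  then show ?case
    using set by (simp add: sets_mu emeasure_eq_measure measure_mu sum_distrib_left
        ennreal_mult[symmetric] sum_ennreal)
next
  case (mult u c)
  note [measurable] = mult(2)
  show ?case
    using mult by (simp add: nn_integral_cmult sum_distrib_left mult.left_commute)
next
  case (add u v)
  note [measurable] = add(1,4)
  show ?case using add by (simp add: nn_integral_add sum.distrib distrib_left)
next
  case (seq U)
  note [measurable] = seq(1)
  have inc: "incseq (\<lambda>i x. U i (tau R b x))" for b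
    using seq(3) by (auto simp: incseq_def le_fun_def)
  have "(\<integral>\<^sup>+x. (SUP i. U i) (tau R b x) \<partial>\<mu>) = (SUP i. \<integral>\<^sup>+x. U i (tau R b x) \<partial>\<mu>)" for b
    unfolding SUP_apply using inc by (intro nn_integral_monotone_convergence_SUP) auto
  moreover have "(\<integral>\<^sup>+x. (SUP i. U i) x \<partial>\<mu>) = (SUP i. \<integral>\<^sup>+x. U i x \<partial>\<mu>)"
    unfolding SUP_apply using seq(3) by (intro nn_integral_monotone_convergence_SUP) auto
  moreover have "(SUP i. \<Sum>b\<in>B. ennreal (1 / real (card B)) * (\<integral>\<^sup>+x. U i (tau R b x) \<partial>\<mu>))
     = (\<Sum>b\<in>B. SUP i. ennreal (1 / real (card B)) * (\<integral>\<^sup>+x. U i (tau R b x) \<partial>\<mu>))"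
  proof (rule ennreal_SUP_sum)
    show "incseq (\<lambda>i. ennreal (1 / real (card B)) * (\<integral>\<^sup>+x. U i (tau R b x) \<partial>\<mu>))" for b
      using inc[of b] by (auto simp: incseq_def le_fun_def intro!: mult_left_mono nn_integral_mono)
  qed
  ultimately show ?case
    using seq by (simp add: SUP_mult_left_ennreal)
qed

text \<open>Each branch term is dominated by the whole sum in \<open>nn_integral_mu\<close>, and its
  weight \<open>1 / card B\<close> is positive.\<close>

lemma integrable_tau:
  fixes f :: "real \<Rightarrow> 'b::{banach, second_countable_topology}"
  assumes f: "integrable \<mu> f" and b: "b \<in> B"
  shows "integrable \<mu> (\<lambda>x. f (tau R b x))"
proof -
  have fm [measurable]: "f \<in> borel_measurable borel"
    using borel_measurable_integrable[OF f] by (simp add: measurable_cong_sets[OF sets_mu refl])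
  let ?I = "\<lambda>b. ennreal (1 / real (card B)) * (\<integral>\<^sup>+x. ennreal (norm (f (tau R b x))) \<partial>\<mu>)"
  have "?I b \<le> (\<Sum>b\<in>B. ?I b)"
    by (rule member_le_sum) (use b B in auto)
  also have "\<dots> = (\<integral>\<^sup>+x. ennreal (norm (f x)) \<partial>\<mu>)"
    by (intro nn_integral_mu[symmetric]) measurable
  also have "\<dots> < \<infinity>" using f by (simp add: integrable_iff_bounded)
  finally have "(\<integral>\<^sup>+x. ennreal (norm (f (tau R b x))) \<partial>\<mu>) < \<infinity>"
    using card_B by (auto simp: ennreal_mult_less_top)
  then show ?thesis by (auto simp: integrable_iff_bounded)
qed

text \<open>For indicators this is the invariance of the measure. Dominated convergence passes both
  sides to limits, with \<open>integrable_tau\<close> supplying the dominating function on each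
  branch.\<close>

lemma integral_mu:
  fixes f :: "real \<Rightarrow> 'b::{banach, second_countable_topology}"
  assumes f: "integrable \<mu> f"
  shows "(\<integral>x. f x \<partial>\<mu>) = (1 / real (card B)) *\<^sub>R (\<Sum>b\<in>B. \<integral>x. f (tau R b x) \<partial>\<mu>)"
  using f
proof (induction rule: integrable_induct)
  case (base A c)
  have A: "A \<in> sets borel" using base(1) by (simp add: sets_mu)
  have "(\<integral>x. indicator A (tau R b x) *\<^sub>R c \<partial>\<mu>) = measure \<mu> (tau R b -` A) *\<^sub>R c" for b
  proof -
    have "tau R b -` A \<in> sets borel"
      using measurable_sets[OF tau_measurable A, of b] by simp
    moreover have "(indicator A (tau R b x) :: real) = indicator (tau R b -` A) x" for x
      by (simp add: indicator_def)
    ultimately show ?thesis by (simp add: sets_mu emeasure_eq_measure del: vimage_eq)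
  qed
  then show ?case
    using A by (simp add: sets_mu emeasure_eq_measure measure_mu scaleR_sum_left[symmetric])
next
  case (add f g)
  then show ?case by (simp add: integrable_tau sum.distrib scaleR_add_right)
next
  case (lim f s)
  have "(\<lambda>i. \<integral>x. s i x \<partial>\<mu>) \<longlonglongrightarrow> (\<integral>x. f x \<partial>\<mu>)"
    by (rule integral_dominated_convergence[where w = "\<lambda>x. 2 * norm (f x)"]) (use lim in auto)
  moreover have "(\<lambda>i. (1 / real (card B)) *\<^sub>R (\<Sum>b\<in>B. \<integral>x. s i (tau R b x) \<partial>\<mu>))
     \<longlonglongrightarrow> (1 / real (card B)) *\<^sub>R (\<Sum>b\<in>B. \<integral>x. f (tau R b x) \<partial>\<mu>)"
  proof (intro tendsto_intros)
    fix b assume b: "b \<in> B"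
    show "(\<lambda>i. \<integral>x. s i (tau R b x) \<partial>\<mu>) \<longlonglongrightarrow> (\<integral>x. f (tau R b x) \<partial>\<mu>)"
      by (rule integral_dominated_convergence[where w = "\<lambda>x. 2 * norm (f (tau R b x))"])
        (use lim integrable_tau[OF lim.hyps(4) b] integrable_tau[OF lim.hyps(1) b] in auto)
  qed
  ultimately show ?case using LIMSEQ_unique lim.IH by simp
qed

lemma L2_tau:
  assumes f: "f \<in> L2 \<mu>" and b: "b \<in> B"
  shows "(\<lambda>x. f (tau R b x)) \<in> L2 \<mu>"
proof -
  have [measurable]: "f \<in> borel_measurable borel"
    using L2_measurable[OF f] by (simp add: measurable_cong_sets[OF sets_mu refl])
  show ?thesis
    using integrable_tau[OF L2_integrable[OF f] b] by (simp add: L2_def)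
qed

section \<open>Exponentials and the Fourier transform of the invariant measure\<close>

lemma expo_L2: "expo t \<in> L2 \<mu>"
  by (intro trig_poly_in_L2 trig_poly_expo)

text \<open>The constant factor is written \<open>expo (t * b / R) 1\<close> so that for
  \<open>t = l\<close> it is literally the phase in the matrix of the orthogonality
  hypothesis.\<close>

lemma expo_tau: "expo t (tau R b x) = expo (t / R) x * expo (t * b / R) 1"
  by (simp add: tau_def add_divide_distrib expo_add_arg) (simp add: expo_def)

lemma frame_elem_L2: "frame_elem R \<alpha> w \<in> L2 \<mu>"
  unfolding frame_elem_def by (intro L2_scale expo_L2)

text \<open>Cauchy-Schwarz against the constant 1 on a probability space, obtained from the
  nonnegativity of the variance of \<open>cmod (f x)\<close>.\<close>

lemma L2_inner_one_le:
  assumes f: "f \<in> L2 \<mu>"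
  shows "(cmod (L2_inner \<mu> f (\<lambda>_. 1)))\<^sup>2 \<le> L2_normsq \<mu> f"
proof -
  have one: "(\<lambda>_. 1) \<in> L2 \<mu>" by (intro trig_poly_in_L2 trig_poly_const)
  have int: "integrable \<mu> f" using L2_inner_integrable[OF f one] by simp
  have "cmod (L2_inner \<mu> f (\<lambda>_. 1)) \<le> (\<integral>x. cmod (f x) \<partial>\<mu>)"
    unfolding L2_inner_def using integral_norm_bound[of \<mu> f] by simp
  then have "(cmod (L2_inner \<mu> f (\<lambda>_. 1)))\<^sup>2 \<le> (\<integral>x. cmod (f x) \<partial>\<mu>)\<^sup>2"
    by (intro power_mono) auto
  also have "\<dots> \<le> L2_normsq \<mu> f"
    using variance_eq[OF integrable_norm[OF int] L2_integrable[OF f]] variance_positive[of "\<lambda>x. cmod (f x)"]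
    by (simp add: L2_normsq_def)
  finally show ?thesis .
qed

text \<open>The refinement equation of the Fourier transform. It describes the move along the digit
  0, from \<open>t\<close> to \<open>t / R\<close>.\<close>

lemma fourier_mu: "L2_inner \<mu> (expo t) (\<lambda>_. 1) = mB B (t / R) * L2_inner \<mu> (expo (t / R)) (\<lambda>_. 1)"
proof -
  have "integrable \<mu> (expo t)"
    using L2_inner_integrable[OF expo_L2 trig_poly_in_L2[OF trig_poly_const], of t 1] by simp
  then have "(\<integral>x. expo t x \<partial>\<mu>) = (1 / real (card B)) *\<^sub>R (\<Sum>b\<in>B. \<integral>x. expo t (tau R b x) \<partial>\<mu>)"
    by (rule integral_mu)
  also have "(\<Sum>b\<in>B. \<integral>x. expo t (tau R b x) \<partial>\<mu>) = (\<Sum>b\<in>B. expo b (t / R) * (\<integral>x. expo (t / R) x \<partial>\<mu>))"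
  proof (rule sum.cong[OF refl])
    fix b
    have "expo t (tau R b x) = expo b (t / R) * expo (t / R) x" for x
      unfolding expo_tau by (simp add: expo_def mult_ac)
    then show "(\<integral>x. expo t (tau R b x) \<partial>\<mu>) = expo b (t / R) * (\<integral>x. expo (t / R) x \<partial>\<mu>)"
      by (simp only: integral_mult_right_zero)
  qed
  finally show ?thesis
    by (simp add: L2_inner_def mB_def scaleR_conv_of_real sum_distrib_right[symmetric] mult.assoc)
qed

end

section \<open>The Bessel inequality\<close>

definition words :: "int set \<Rightarrow> nat \<Rightarrow> int list set" where
  "words L n = {w. set w \<subseteq> L \<and> length w = n}"

lemma finite_words: "finite L \<Longrightarrow> finite (words L n)"
  unfolding words_def by (rule finite_lists_length_eq)

lemma words_0: "words L 0 = {[]}"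
  by (auto simp: words_def)

lemma sum_words_Suc:
  assumes "finite L"
  shows "(\<Sum>w\<in>words L (Suc n). F w) = (\<Sum>l\<in>L. \<Sum>w\<in>words L n. F (l # w))"
proof -
  have eq: "words L (Suc n) = (\<lambda>(l, w). l # w) ` (L \<times> words L n)"
  proof
    show "words L (Suc n) \<subseteq> (\<lambda>(l, w). l # w) ` (L \<times> words L n)"
    proof
      fix w assume "w \<in> words L (Suc n)"
      then obtain l v where "w = l # v" "l \<in> L" "v \<in> words L n"
        by (cases w) (auto simp: words_def)
      then show "w \<in> (\<lambda>(l, w). l # w) ` (L \<times> words L n)" by force
    qed
  qed (auto simp: words_def)
  have "(\<Sum>w\<in>words L (Suc n). F w) = (\<Sum>(l, w)\<in>L \<times> words L n. F (l # w))"
    unfolding eq by (subst sum.reindex) (auto simp: inj_on_def intro!: sum.cong)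
  then show ?thesis by (simp add: sum.cartesian_product)
qed

locale ifs_frame = ifs_measure R B \<mu>
  for R :: int and B :: "int set" and \<mu> :: "real measure" +
  fixes L :: "int set" and \<alpha> :: "int \<Rightarrow> complex"
  assumes L: "finite L" "0 \<in> L"
    and a0: "\<alpha> 0 = 1"
    and orth: "\<forall>b\<in>B. \<forall>b'\<in>B.
       (\<Sum>l\<in>L. (1 / of_nat (card B)) *
          (expo (real_of_int l * real_of_int b / real_of_int R) 1 * \<alpha> l) *
          cnj (expo (real_of_int l * real_of_int b' / real_of_int R) 1 * \<alpha> l))
       = (if b = b' then 1 else 0)"
begin

text \<open>The adjoint is written explicitly as an average over the digits, so its properties
  follow from \<open>integral_mu\<close>.\<close>

definition T :: "int \<Rightarrow> (real \<Rightarrow> complex) \<Rightarrow> real \<Rightarrow> complex" where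
  "T l f x = (1 / of_nat (card B)) * (\<Sum>b\<in>B. cnj (\<alpha> l * expo l (tau R b x)) * f (tau R b x))"

text \<open>Orthonormal columns make the matrix an isometry: expanding the squares and exchanging
  the sums leaves only the diagonal. The factor \<open>card B\<close> appears because the entries
  here lack the normalization by the root of \<open>card B\<close>.\<close>

lemma sum_cmod_coefficients:
  fixes a :: "int \<Rightarrow> complex"
  shows "(\<Sum>l\<in>L. (cmod (\<Sum>b\<in>B. cnj (expo (real_of_int l * real_of_int b / R) 1 * \<alpha> l) * a b))\<^sup>2) = card B * (\<Sum>b\<in>B. (cmod (a b))\<^sup>2)"
proof -
  let ?E = "\<lambda>l b. expo (real_of_int l * real_of_int b / real_of_int R) 1 * \<alpha> l"
  have o: "(\<Sum>l\<in>L. ?E l b' * cnj (?E l b)) = (if b = b' then of_nat (card B) else 0)"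
    if "b \<in> B" "b' \<in> B" for b b'
  proof -
    have "(\<Sum>l\<in>L. ?E l b' * cnj (?E l b)) = of_nat (card B) *
        (\<Sum>l\<in>L. (1 / of_nat (card B)) * ?E l b' * cnj (?E l b))"
      using card_B by (simp add: sum_distrib_left mult.assoc)
    also have "\<dots> = of_nat (card B) * (if b' = b then 1 else 0)"
      by (rule arg_cong[OF bspec[OF bspec[OF orth that(2)] that(1)]])
    finally show ?thesis by simp
  qed
  have "complex_of_real (\<Sum>l\<in>L. (cmod (\<Sum>b\<in>B. cnj (?E l b) * a b))\<^sup>2)
      = (\<Sum>l\<in>L. (\<Sum>b\<in>B. cnj (?E l b) * a b) * cnj (\<Sum>b\<in>B. cnj (?E l b) * a b))"
    by (simp add: complex_norm_square del: of_real_power)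
  also have "\<dots> = (\<Sum>l\<in>L. (\<Sum>b\<in>B. cnj (?E l b) * a b) * (\<Sum>b\<in>B. ?E l b * cnj (a b)))"
    by simp
  also have "\<dots> = (\<Sum>l\<in>L. \<Sum>b\<in>B. \<Sum>b'\<in>B. (a b * cnj (a b')) * (?E l b' * cnj (?E l b)))"
    unfolding sum_product by (intro sum.cong refl) (simp only: mult_ac)
  also have "\<dots> = (\<Sum>b\<in>B. \<Sum>b'\<in>B. \<Sum>l\<in>L. (a b * cnj (a b')) * (?E l b' * cnj (?E l b)))"
    by (subst sum.swap) (intro sum.cong refl sum.swap)
  also have "\<dots> = (\<Sum>b\<in>B. \<Sum>b'\<in>B. (a b * cnj (a b')) * (if b = b' then of_nat (card B) else 0))"
    unfolding sum_distrib_left[symmetric] by (intro sum.cong refl arg_cong2[where f = "(*)"] o)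
  also have "\<dots> = (\<Sum>b\<in>B. (a b * cnj (a b)) * of_nat (card B))"
    using B(1) by (intro sum.cong refl) (simp add: if_distrib cong: if_cong)
  also have "\<dots> = complex_of_real (card B * (\<Sum>b\<in>B. (cmod (a b))\<^sup>2))"
    by (simp add: complex_norm_square sum_distrib_left mult.commute del: of_real_power)
  finally show ?thesis by (simp only: of_real_eq_iff)
qed

text \<open>The factor \<open>expo (l / R) x\<close> is common to all digits and has modulus 1; once
  it is pulled out, the matrix isometry applies at each point \<open>x\<close>.\<close>

lemma sum_cmod_T: "(\<Sum>l\<in>L. (cmod (T l f x))\<^sup>2) = (1 / card B) * (\<Sum>b\<in>B. (cmod (f (tau R b x)))\<^sup>2)"
proof -
  have "(cmod (T l f x))\<^sup>2 = (1 / card B)\<^sup>2 *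
      (cmod (\<Sum>b\<in>B. cnj (expo (real_of_int l * real_of_int b / R) 1 * \<alpha> l) * f (tau R b x)))\<^sup>2" for l
  proof -
    have "T l f x = (1 / of_nat (card B)) * (cnj (expo (l / R) x) *
        (\<Sum>b\<in>B. cnj (expo (real_of_int l * real_of_int b / R) 1 * \<alpha> l) * f (tau R b x)))"
      unfolding T_def expo_tau sum_distrib_left by (simp add: mult_ac)
    then show ?thesis by (simp add: norm_mult norm_divide power_mult_distrib power_divide)
  qed
  then have "(\<Sum>l\<in>L. (cmod (T l f x))\<^sup>2)
      = (1 / card B)\<^sup>2 * (card B * (\<Sum>b\<in>B. (cmod (f (tau R b x)))\<^sup>2))"
    by (simp only: sum_distrib_left[symmetric] sum_cmod_coefficients)
  then show ?thesis using card_B by (simp add: power2_eq_square)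
qed

lemma T_L2:
  assumes f: "f \<in> L2 \<mu>"
  shows "T l f \<in> L2 \<mu>"
proof -
  have "(\<lambda>x. cnj (\<alpha> l * expo l (tau R b x)) * f (tau R b x)) \<in> L2 \<mu>" if b: "b \<in> B" for b
  proof -
    have "(\<lambda>x. cnj (\<alpha> l) * (expo (-l) x * f x)) \<in> L2 \<mu>"
    proof (rule L2_scale)
      have [measurable]: "f \<in> borel_measurable \<mu>" using f by (rule L2_measurable)
      show "(\<lambda>x. expo (-l) x * f x) \<in> L2 \<mu>"
        using L2_integrable[OF f] by (simp add: L2_def norm_mult)
    qed
    from L2_tau[OF this b] show ?thesis by (simp add: cnj_expo mult.assoc)
  qed
  then have "(\<lambda>x. (1 / of_nat (card B)) * (\<Sum>b\<in>B. cnj (\<alpha> l * expo l (tau R b x)) * f (tau R b x))) \<in> L2 \<mu>"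
    by (intro L2_scale L2_sum B)
  then show ?thesis by (simp add: T_def[abs_def])
qed

lemma sum_normsq_T:
  assumes f: "f \<in> L2 \<mu>"
  shows "(\<Sum>l\<in>L. L2_normsq \<mu> (T l f)) = L2_normsq \<mu> f"
proof -
  have "(\<Sum>l\<in>L. L2_normsq \<mu> (T l f)) = (\<integral>x. (\<Sum>l\<in>L. (cmod (T l f x))\<^sup>2) \<partial>\<mu>)"
    unfolding L2_normsq_def by (intro Bochner_Integration.integral_sum[symmetric] L2_integrable T_L2 f)
  also have "\<dots> = (1 / card B) * (\<Sum>b\<in>B. \<integral>x. (cmod (f (tau R b x)))\<^sup>2 \<partial>\<mu>)"
    unfolding sum_cmod_T using integrable_tau[OF L2_integrable[OF f]] by simp
  also have "\<dots> = L2_normsq \<mu> f"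
    unfolding L2_normsq_def using integral_mu[OF L2_integrable[OF f]] by simp
  finally show ?thesis .
qed

lemma expo_int_eq_1: "expo (real_of_int k) (real_of_int m) = 1"
proof -
  have "expo (real_of_int k) (real_of_int m) = exp (complex_of_real (2 * of_int (k * m) * pi) * \<i>)"
    by (simp add: expo_def mult_ac)
  also have "\<dots> = 1" by (rule exp_integer_2pi) simp
  finally show ?thesis .
qed

text \<open>Frequencies and digits are integers, so \<open>expo (R * \<lambda>) \<circ> tau R b = expo \<lambda>\<close> for every digit \<open>b\<close>.\<close>

lemma frame_elem_Cons_tau:
  "frame_elem R \<alpha> (l # w) (tau R b x) = \<alpha> l * expo l (tau R b x) * frame_elem R \<alpha> w x"
proof -
  have "expo (R * freq R w) (tau R b x) = expo (freq R w) (x + real_of_int b)"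
    using R_nz by (simp add: expo_def tau_def)
  also have "\<dots> = expo (freq R w) x"
    by (simp add: expo_add_arg expo_int_eq_1)
  finally show ?thesis by (simp add: frame_elem_def expo_add)
qed

text \<open>Self-similarity turns the inner product into an average over branches. On each branch
  the frame element splits off the factor for \<open>l\<close>, while the factor for
  \<open>w\<close> does not depend on the digit.\<close>

lemma L2_inner_frame_Cons:
  assumes f: "f \<in> L2 \<mu>"
  shows "L2_inner \<mu> f (frame_elem R \<alpha> (l # w)) = L2_inner \<mu> (T l f) (frame_elem R \<alpha> w)"
proof -
  let ?g = "\<lambda>x. f x * cnj (frame_elem R \<alpha> (l # w) x)"
  have int: "integrable \<mu> ?g"
    by (rule L2_inner_integrable[OF f frame_elem_L2])
  have "L2_inner \<mu> f (frame_elem R \<alpha> (l # w)) = (1 / card B) *\<^sub>R (\<Sum>b\<in>B. \<integral>x. ?g (tau R b x) \<partial>\<mu>)"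
    unfolding L2_inner_def by (rule integral_mu[OF int])
  also have "\<dots> = (1 / card B) *\<^sub>R (\<integral>x. (\<Sum>b\<in>B. ?g (tau R b x)) \<partial>\<mu>)"
    using integrable_tau[OF int] by (subst Bochner_Integration.integral_sum) auto
  also have "\<dots> = (\<integral>x. (1 / of_nat (card B)) * (\<Sum>b\<in>B. ?g (tau R b x)) \<partial>\<mu>)"
    by (simp add: scaleR_conv_of_real)
  also have "\<dots> = L2_inner \<mu> (T l f) (frame_elem R \<alpha> w)"
    unfolding L2_inner_def T_def frame_elem_Cons_tau
    by (intro Bochner_Integration.integral_cong refl)
      (simp add: sum_distrib_left sum_distrib_right mult_ac)
  finally show ?thesis .
qed

text \<open>Each digit contributes the same exponential of frequency \<open>gl R l t\<close> with
  phase \<open>expo b (gl R l t)\<close>; averaging these phases gives \<open>mB\<close>.\<close>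

lemma T_expo: "T l (expo t) = (\<lambda>x. (cnj (\<alpha> l) * mB B (gl R l t)) * expo (gl R l t) x)"
proof
  fix x
  have *: "cnj (expo l (tau R b x)) * expo t (tau R b x) = expo b (gl R l t) * expo (gl R l t) x" for b
  proof -
    have "cnj (expo l (tau R b x)) * expo t (tau R b x) = expo (t - l) (tau R b x)"
      by (simp add: cnj_expo expo_add[symmetric])
    also have "\<dots> = expo (gl R l t) (x + b)"
      by (simp add: expo_def tau_def gl_def)
    also have "\<dots> = expo b (gl R l t) * expo (gl R l t) x"
      by (simp add: expo_add_arg) (simp add: expo_def mult_ac)
    finally show ?thesis .
  qed
  have "T l (expo t) x = (1 / of_nat (card B)) * (\<Sum>b\<in>B. cnj (\<alpha> l) * (expo b (gl R l t) * expo (gl R l t) x))"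
    unfolding T_def *[symmetric] by (simp add: mult_ac)
  then show "T l (expo t) x = (cnj (\<alpha> l) * mB B (gl R l t)) * expo (gl R l t) x"
    by (simp add: mB_def sum_distrib_left sum_distrib_right mult_ac)
qed

text \<open>All words of length exactly \<open>n\<close> are taken, including those ending in 0, so
  that splitting off the first letter gives a clean recursion through \<open>T\<close>.\<close>

definition G :: "nat \<Rightarrow> (real \<Rightarrow> complex) \<Rightarrow> real" where
  "G n f = (\<Sum>w\<in>words L n. (cmod (L2_inner \<mu> f (frame_elem R \<alpha> w)))\<^sup>2)"

lemma frame_elem_Nil: "frame_elem R \<alpha> [] = (\<lambda>_. 1)"
  by (simp add: frame_elem_def fun_eq_iff)

lemma G_0: "G 0 f = (cmod (L2_inner \<mu> f (\<lambda>_. 1)))\<^sup>2"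
  by (simp add: G_def words_0 frame_elem_Nil)

lemma G_Suc:
  assumes "f \<in> L2 \<mu>"
  shows "G (Suc n) f = (\<Sum>l\<in>L. G n (T l f))"
  unfolding G_def by (simp add: sum_words_Suc L2_inner_frame_Cons assms L)

text \<open>The bound for length \<open>n\<close> is applied to every \<open>T l f\<close>; their
  squared norms add up to that of \<open>f\<close>. The base case is Cauchy-Schwarz against the
  constant 1.\<close>

lemma bessel:
  assumes "f \<in> L2 \<mu>"
  shows "G n f \<le> L2_normsq \<mu> f"
  using assms
proof (induction n arbitrary: f)
  case 0
  then show ?case by (simp add: G_0 L2_inner_one_le)
next
  case (Suc n)
  have "G (Suc n) f \<le> (\<Sum>l\<in>L. L2_normsq \<mu> (T l f))"
    unfolding G_Suc[OF Suc.prems] by (intro sum_mono Suc.IH T_L2 Suc.prems)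
  then show ?case by (simp add: sum_normsq_T Suc.prems)
qed

lemma G_scale: "G n (\<lambda>x. c * f x) = (cmod c)\<^sup>2 * G n f"
  by (simp add: G_def L2_inner_scale_left norm_mult power_mult_distrib sum_distrib_left)

text \<open>\<open>G n\<close> is a quadratic form, and so is the defect of the Bessel
  inequality.\<close>

lemma G_parallelogram:
  assumes "f \<in> L2 \<mu>" "g \<in> L2 \<mu>"
  shows "G n (\<lambda>x. f x + g x) + G n (\<lambda>x. f x - g x) = 2 * G n f + 2 * G n g"
  unfolding G_def
  by (simp add: L2_inner_add_left L2_inner_diff_left assms frame_elem_L2 sum.distrib[symmetric]
      cmod_parallelogram sum_distrib_left)

lemma freq_append_0: "freq R (w @ [0]) = freq R w"
  by (induction w) auto

lemma frame_elem_append_0: "frame_elem R \<alpha> (w @ [0]) = frame_elem R \<alpha> w"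
  by (simp add: frame_elem_def freq_append_0 a0 fun_eq_iff)

lemma finite_Omega_le: "finite {w \<in> Omega L. length w \<le> n}"
  by (rule finite_subset[OF _ finite_lists_length_le[OF L(1), of n]]) (auto simp: Omega_def)

text \<open>Since \<open>\<alpha> 0 = 1\<close>, trailing zeros do not change a frame element, so words of length \<open>n\<close>
  enumerate the frame elements of the words in \<open>\<Omega>(L)\<close> of length at most \<open>n\<close>.\<close>

lemma G_eq_sum_Omega:
  "G n f = (\<Sum>w\<in>{w \<in> Omega L. length w \<le> n}. (cmod (L2_inner \<mu> f (frame_elem R \<alpha> w)))\<^sup>2)"
proof (induction n)
  case 0
  have "{w \<in> Omega L. length w \<le> 0} = {[]}" by (auto simp: Omega_def)
  then show ?case by (simp add: G_def words_0)
next
  case (Suc n)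
  let ?F = "\<lambda>w. (cmod (L2_inner \<mu> f (frame_elem R \<alpha> w)))\<^sup>2"
  let ?W = "{w \<in> words L (Suc n). last w \<noteq> 0}"
  have fin: "finite ?W" "finite (words L n)" using finite_words[OF L(1)] by auto
  have W: "words L (Suc n) = ?W \<union> (\<lambda>w. w @ [0]) ` words L n"
  proof (intro equalityI subsetI)
    fix w assume w: "w \<in> words L (Suc n)"
    then have "w = butlast w @ [last w]" by (cases w) (auto simp: words_def)
    moreover have "butlast w \<in> words L n"
      using w by (auto simp: words_def dest: in_set_butlastD)
    ultimately show "w \<in> ?W \<union> (\<lambda>w. w @ [0]) ` words L n" using w by (cases "last w = 0") auto
  qed (use L(2) in \<open>auto simp: words_def\<close>)
  have "G (Suc n) f = (\<Sum>w\<in>?W. ?F w) + (\<Sum>w\<in>(\<lambda>w. w @ [0]) ` words L n. ?F w)"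
    unfolding G_def by (subst W, rule sum.union_disjoint) (use fin in auto)
  also have "(\<Sum>w\<in>(\<lambda>w. w @ [0]) ` words L n. ?F w) = G n f"
    by (subst sum.reindex) (auto simp: inj_on_def frame_elem_append_0 G_def)
  also have "\<dots> = (\<Sum>w\<in>{w \<in> Omega L. length w \<le> n}. ?F w)" by (rule Suc)
  also have "(\<Sum>w\<in>?W. ?F w) + \<dots> = (\<Sum>w\<in>?W \<union> {w \<in> Omega L. length w \<le> n}. ?F w)"
    using fin finite_Omega_le by (intro sum.union_disjoint[symmetric]) (auto simp: words_def)
  also have "?W \<union> {w \<in> Omega L. length w \<le> n} = {w \<in> Omega L. length w \<le> Suc n}"
    by (auto simp: words_def Omega_def le_Suc_eq)
  finally show ?case .
qed

lemma G_incseq: "incseq (\<lambda>n. G n f)"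
  unfolding G_eq_sum_Omega by (intro monoI sum_mono2 finite_Omega_le) auto

text \<open>The limit along word length is the unordered sum: the terms are nonnegative with bounded
  partial sums, and every finite set of words lies among the words of some bounded length.\<close>

lemma has_sum_frame:
  assumes lim: "(\<lambda>n. G n f) \<longlonglongrightarrow> s"
  shows "((\<lambda>w. (cmod (L2_inner \<mu> f (frame_elem R \<alpha> w)))\<^sup>2) has_sum s) (Omega L)"
proof -
  let ?F = "\<lambda>w. (cmod (L2_inner \<mu> f (frame_elem R \<alpha> w)))\<^sup>2"
  have "?F summable_on Omega L"
  proof (rule nonneg_bounded_partial_sums_imp_summable_on)
    show "\<forall>\<^sub>F X in finite_subsets_at_top (Omega L). sum ?F X \<le> s"
    proof (rule eventually_finite_subsets_at_top_weakI)
      fix X assume X: "finite X" "X \<subseteq> Omega L"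
      \<comment> \<open>Inserting 0 keeps \<open>Max\<close> meaningful when \<open>X\<close> is
        empty.\<close>
      then have "X \<subseteq> {w \<in> Omega L. length w \<le> Max (insert 0 (length ` X))}" by auto
      then have "sum ?F X \<le> G (Max (insert 0 (length ` X))) f"
        unfolding G_eq_sum_Omega by (intro sum_mono2 finite_Omega_le) auto
      also have "\<dots> \<le> s" by (rule incseq_le[OF G_incseq lim])
      finally show "sum ?F X \<le> s" .
    qed
  qed simp
  then obtain s' where s': "(?F has_sum s') (Omega L)" by (auto simp: summable_on_def)
  have "filterlim (\<lambda>n. {w \<in> Omega L. length w \<le> n}) (finite_subsets_at_top (Omega L)) sequentially"
    unfolding filterlim_finite_subsets_at_top
  proof (intro allI impI)
    fix X assume X: "finite X \<and> X \<subseteq> Omega L"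
    have "X \<subseteq> {w \<in> Omega L. length w \<le> n}" if "n \<ge> Max (insert 0 (length ` X))" for n
      using X that by auto
    then show "\<forall>\<^sub>F n in sequentially. finite {w \<in> Omega L. length w \<le> n} \<and>
        X \<subseteq> {w \<in> Omega L. length w \<le> n} \<and> {w \<in> Omega L. length w \<le> n} \<subseteq> Omega L"
      using finite_Omega_le unfolding eventually_sequentially by auto
  qed
  with s' have "(\<lambda>n. sum ?F {w \<in> Omega L. length w \<le> n}) \<longlonglongrightarrow> s'"
    unfolding has_sum_def by (rule filterlim_compose)
  then have "(\<lambda>n. G n f) \<longlonglongrightarrow> s'" by (simp add: G_eq_sum_Omega)
  with lim have "s = s'" by (rule LIMSEQ_unique)
  with s' show ?thesis by simp
qed

end

section \<open>Entire extension of Fourier transforms\<close>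

text \<open>Off the real axis this grows exponentially in \<open>x\<close>; the bounded support of
  the measure keeps it square-integrable.\<close>

definition cexpo :: "complex \<Rightarrow> real \<Rightarrow> complex" where
  "cexpo z x = exp (2 * complex_of_real pi * \<i> * z * complex_of_real x)"

lemma cexpo_of_real: "cexpo (complex_of_real t) = expo t"
  by (simp add: cexpo_def expo_def fun_eq_iff mult.assoc)

lemma cexpo_mult_cnj_expo: "cexpo z x * cnj (expo t x) = cexpo (z - complex_of_real t) x"
  unfolding cnj_expo by (simp add: cexpo_def expo_def exp_add[symmetric] algebra_simps)

lemma cnj_cexpo: "cnj (cexpo z x) = cexpo (- cnj z) x"
  by (simp add: cexpo_def exp_cnj)

lemma cexpo_measurable [measurable]: "cexpo z \<in> borel_measurable borel"
  unfolding cexpo_def by (intro borel_measurable_continuous_onI continuous_intros)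

lemma cmod_cexpo_le:
  assumes "\<bar>x\<bar> \<le> r"
  shows "cmod (cexpo z x) \<le> exp (2 * pi * cmod z * r)"
proof -
  have "cmod (cexpo z x) \<le> exp (cmod (2 * complex_of_real pi * \<i> * z * complex_of_real x))"
    unfolding cexpo_def by (rule norm_exp)
  also have "\<dots> = exp (2 * pi * cmod z * \<bar>x\<bar>)" by (simp add: norm_mult)
  also have "\<dots> \<le> exp (2 * pi * cmod z * r)" using assms by (simp add: mult_left_mono)
  finally show ?thesis .
qed

context compactly_supported_measure
begin

definition fourier :: "complex \<Rightarrow> complex" where
  "fourier z = (\<integral>x. cexpo z x \<partial>\<mu>)"

lemma cexpo_L2: "cexpo z \<in> L2 \<mu>"
proof (rule L2_bounded[OF finite_measure_axioms])
  show "AE x in \<mu>. cmod (cexpo z x) \<le> exp (2 * pi * cmod z * r)"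
    using support by eventually_elim (rule cmod_cexpo_le)
qed measurable

text \<open>For real arguments the conjugate becomes the value at the negative, which replaces
  squared moduli by products of holomorphic functions.\<close>

lemma cnj_fourier: "cnj (fourier z) = fourier (- cnj z)"
proof -
  have "cexpo (- cnj z) = (\<lambda>x. cnj (cexpo z x))" by (simp add: cnj_cexpo fun_eq_iff)
  then show ?thesis unfolding fourier_def by simp
qed

text \<open>The exponential series is integrated term by term: on the support its terms are
  dominated by those of the series for \<open>exp (2 * pi * cmod z * \<bar>r\<bar>)\<close>. The
  resulting power series converges on every disk around 0.\<close>

lemma fourier_holomorphic: "fourier holomorphic_on S"
proof -
  define a where "a n = (2 * complex_of_real pi * \<i>) ^ n / fact n * (\<integral>x. complex_of_real x ^ n \<partial>\<mu>)" for n
  have pow_bound: "AE x in \<mu>. cmod (complex_of_real x ^ n) \<le> \<bar>r\<bar> ^ n" for n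
    using support by eventually_elim (auto simp: norm_power intro!: power_mono)
  have pow_int: "integrable \<mu> (\<lambda>x. complex_of_real x ^ n)" for n
    by (rule integrable_const_bound[OF pow_bound]) measurable
  have sums: "(\<lambda>n. a n * (z - 0) ^ n) sums fourier z" for z
  proof -
    define f where "f n x = (2 * complex_of_real pi * \<i> * z) ^ n / fact n * complex_of_real x ^ n" for n and x :: real
    have f_exp: "f n x = (2 * complex_of_real pi * \<i> * z * complex_of_real x) ^ n /\<^sub>R fact n" for n x
      by (simp add: f_def power_mult_distrib scaleR_conv_of_real field_simps)
    have f_int: "integrable \<mu> (f n)" for n
      unfolding f_def by (intro integrable_mult_right pow_int)
    define C where "C = 2 * pi * cmod z * \<bar>r\<bar>"
    have "summable (\<lambda>n. C ^ n /\<^sub>R fact n * measure \<mu> UNIV)"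
      by (intro summable_mult2 summable_exp_generic)
    moreover have "norm (\<integral>x. norm (f n x) \<partial>\<mu>) \<le> C ^ n /\<^sub>R fact n * measure \<mu> UNIV" for n
    proof -
      have "(\<integral>x. norm (f n x) \<partial>\<mu>) \<le> (\<integral>x. C ^ n /\<^sub>R fact n \<partial>\<mu>)"
      proof (rule integral_mono_AE)
        show "AE x in \<mu>. norm (f n x) \<le> C ^ n /\<^sub>R fact n"
          using pow_bound[of n]
        proof eventually_elim
          case (elim x)
          have "norm (f n x) = (2 * pi * cmod z) ^ n / fact n * cmod (complex_of_real x ^ n)"
            by (simp add: f_def norm_mult norm_divide norm_power)
          also have "\<dots> \<le> (2 * pi * cmod z) ^ n / fact n * \<bar>r\<bar> ^ n"
            using elim by (intro mult_left_mono) auto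
          finally show ?case by (simp add: C_def power_mult_distrib field_simps)
        qed
      qed (use f_int in auto)
      then show ?thesis by (simp add: mult_ac)
    qed
    ultimately have summ: "summable (\<lambda>n. \<integral>x. norm (f n x) \<partial>\<mu>)"
      by (rule summable_comparison_test')
    have AE_summ: "AE x in \<mu>. summable (\<lambda>n. norm (f n x))"
      unfolding f_exp by (intro AE_I2 summable_norm_exp)
    have "(\<lambda>n. integral\<^sup>L \<mu> (f n)) sums (\<integral>x. (\<Sum>n. f n x) \<partial>\<mu>)"
      by (rule sums_integral[OF f_int AE_summ summ])
    moreover have "(\<Sum>n. f n x) = cexpo z x" for x
      unfolding f_exp cexpo_def exp_def by simp
    moreover have "integral\<^sup>L \<mu> (f n) = a n * (z - 0) ^ n" for n
      unfolding f_def a_def by (simp add: power_mult_distrib)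
    ultimately show ?thesis by (simp add: fourier_def)
  qed
  have "fourier holomorphic_on ball 0 (real n)" for n
    by (rule power_series_holomorphic) (rule sums)
  then have "fourier field_differentiable at z" for z
  proof -
    obtain n :: nat where "cmod z < n" using reals_Archimedean2 by blast
    then show ?thesis
      using \<open>\<And>n. fourier holomorphic_on ball 0 (real n)\<close>[of n]
      by (auto simp: holomorphic_on_open field_differentiable_def)
  qed
  then show ?thesis
    by (simp add: holomorphic_on_def field_differentiable_at_within)
qed

end

section \<open>Fixed points of the transfer operator\<close>

text \<open>Descent through proper invariant subsets stops in a finite set. Thus a hypothesis on
  minimal sets constrains every finite invariant set.\<close>

lemma finite_invariant_contains_minimal:
  assumes "finite M" "M \<noteq> {}" "invariant_set R B L \<alpha> M"
  shows "\<exists>M'\<subseteq>M. finite_minimal_invariant R B L \<alpha> M'"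
  using assms
proof (induction rule: finite_psubset_induct)
  case (psubset M)
  show ?case
  proof (cases "\<exists>M'. M' \<subset> M \<and> M' \<noteq> {} \<and> invariant_set R B L \<alpha> M'")
    case True
    then obtain M' where M': "M' \<subset> M" "M' \<noteq> {}" "invariant_set R B L \<alpha> M'" by blast
    from psubset.IH[OF this] M'(1) show ?thesis by blast
  next
    case False
    then have "finite_minimal_invariant R B L \<alpha> M"
      using psubset by (auto simp: finite_minimal_invariant_def)
    then show ?thesis by blast
  qed
qed

context ifs_frame
begin

text \<open>The transition probability from \<open>t\<close> to \<open>gl R l t\<close>; the
  transfer operator averages with these weights.\<close>

definition weight :: "int \<Rightarrow> real \<Rightarrow> real" where
  "weight l t = (cmod (\<alpha> l))\<^sup>2 * (cmod (mB B (gl R l t)))\<^sup>2"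

lemma weight_nonneg: "0 \<le> weight l t"
  by (simp add: weight_def)

lemma L2_normsq_expo: "L2_normsq \<mu> (expo t) = 1"
  using prob_space by (simp add: L2_normsq_def)

text \<open>This is the norm identity for \<open>T\<close> evaluated at an exponential.\<close>

lemma sum_weight: "(\<Sum>l\<in>L. weight l t) = 1"
  using sum_normsq_T[OF expo_L2, of t]
  by (simp add: T_expo L2_normsq_scale L2_normsq_expo weight_def norm_mult power_mult_distrib)

text \<open>The shift at most doubles the bound, and division by \<open>R\<close> at least halves
  it.\<close>

lemma gl_in_interval:
  assumes "\<bar>real_of_int l\<bar> \<le> A" "t \<in> {-A..A}"
  shows "gl R l t \<in> {-A..A}"
proof -
  have "\<bar>t - real_of_int l\<bar> \<le> 2 * A" using assms by auto
  also have "\<dots> \<le> \<bar>real_of_int R\<bar> * A" using abs_R_ge assms(1) by (intro mult_right_mono) auto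
  finally have "\<bar>gl R l t\<bar> \<le> A"
    using R_nz by (simp add: gl_def abs_divide divide_le_eq mult.commute)
  then show ?thesis by auto
qed

text \<open>The points of a compact interval, stable under all the maps \<open>gl R l\<close>, where \<open>h\<close> is minimal
  form an invariant set. If that set is finite it contains \<open>0\<close>, so the minimum is
  \<open>h 0 = 1\<close>, which is absurd because then the whole interval is minimal. Hence it is infinite,
  and \<open>h\<close> is constant by the identity theorem.\<close>

lemma entire_fixed_point_eq_1:
  fixes h :: "complex \<Rightarrow> complex"
  assumes only0: "\<And>M. finite_minimal_invariant R B L \<alpha> M \<Longrightarrow> M = {0}"
    and holo: "h holomorphic_on UNIV"
    and real: "\<And>t::real. h (of_real t) \<in> \<real>"
    and le1: "\<And>t::real. Re (h (of_real t)) \<le> 1"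
    and h0: "h 0 = 1"
    and fixp: "\<And>t::real. (\<Sum>l\<in>L. complex_of_real (weight l t) * h (of_real (gl R l t))) = h (of_real t)"
  shows "h = (\<lambda>_. 1)"
proof -
  \<comment> \<open>The added 1 keeps the interval nondegenerate when 0 is the only element of
    \<open>L\<close>.\<close>
  define A where "A = real_of_int (Max (abs ` L)) + 1"
  have LA: "\<bar>real_of_int l\<bar> \<le> A" if "l \<in> L" for l
  proof -
    have "\<bar>l\<bar> \<le> Max (abs ` L)" using that L by (intro Max_ge) auto
    then show ?thesis unfolding A_def by linarith
  qed
  have A: "A > 0"
  proof -
    have "\<bar>0\<bar> \<le> Max (abs ` L)" using L by (intro Max_ge) auto
    then show ?thesis unfolding A_def by linarith
  qed
  define u where "u t = Re (h (of_real t))" for t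
  have hu: "h (of_real t) = of_real (u t)" for t
    unfolding u_def using real[of t] by (simp add: complex_is_Real_iff complex_eq_iff)
  have fixu: "(\<Sum>l\<in>L. weight l t * u (gl R l t)) = u t" for t
    using fixp[of t] by (simp add: hu flip: of_real_mult of_real_sum)
  have "continuous_on UNIV h" using holo by (rule holomorphic_on_imp_continuous_on)
  then have "continuous_on {-A..A} (\<lambda>t. h (complex_of_real t))"
    by (rule continuous_on_compose2) (auto intro: continuous_intros)
  then have cont: "continuous_on {-A..A} u"
    unfolding u_def by (intro continuous_intros)
  obtain t0 where t0: "t0 \<in> {-A..A}" "\<And>t. t \<in> {-A..A} \<Longrightarrow> u t0 \<le> u t"
    using continuous_attains_inf[OF _ _ cont] A by force
  define Z where "Z = {t \<in> {-A..A}. u t = u t0}"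
  have inv: "invariant_set R B L \<alpha> Z"
    unfolding invariant_set_def
  proof (intro ballI impI)
    fix t l assume t: "t \<in> Z" and l: "l \<in> L" and nz: "\<alpha> l * mB B (gl R l t) \<noteq> 0"
    have tK: "t \<in> {-A..A}" and ut: "u t = u t0" using t by (auto simp: Z_def)
    have gK: "gl R k t \<in> {-A..A}" if "k \<in> L" for k
      by (rule gl_in_interval[OF LA[OF that] tK])
    \<comment> \<open>Minimum principle: at a minimum the weighted excesses are nonnegative and sum
      to 0, so each vanishes and every successor of positive weight is again a minimum.\<close>
    have "(\<Sum>k\<in>L. weight k t * (u (gl R k t) - u t0)) = u t - (\<Sum>k\<in>L. weight k t) * u t0"
      by (simp add: right_diff_distrib sum_subtractf fixu sum_distrib_right)
    also have "\<dots> = 0" by (simp add: sum_weight ut)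
    finally have "\<forall>k\<in>L. weight k t * (u (gl R k t) - u t0) = 0"
      using L(1) t0(2)[OF gK] weight_nonneg by (subst (asm) sum_nonneg_eq_0_iff) auto
    moreover have "weight l t \<noteq> 0" using nz by (simp add: weight_def)
    ultimately have "u (gl R l t) = u t0" using l by auto
    then show "gl R l t \<in> Z" using gK[OF l] by (simp add: Z_def)
  qed
  have "infinite Z"
  proof
    assume fin: "finite Z"
    have "Z \<noteq> {}" using t0(1) by (auto simp: Z_def)
    then obtain M where "M \<subseteq> Z" "finite_minimal_invariant R B L \<alpha> M"
      using finite_invariant_contains_minimal[OF fin _ inv] by blast
    with only0 have "0 \<in> Z" by blast
    then have "u t0 = 1" using h0 by (simp add: Z_def u_def)
    moreover have "u t = u t0" if "t \<in> {-A..A}" for t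
      using t0(2)[OF that] le1[of t] \<open>u t0 = 1\<close> unfolding u_def by linarith
    ultimately have "{-A..A} \<subseteq> Z" unfolding Z_def by blast
    then have "finite {-A..A}" using fin by (rule finite_subset)
    then show False using A infinite_Icc[of "-A" A] by simp
  qed
  define f where "f z = h z - of_real (u t0)" for z
  have "f constant_on UNIV"
  proof (rule ccontr)
    assume nc: "\<not> f constant_on UNIV"
    \<comment> \<open>A nonconstant entire function has only finitely many zeros on this compact
      segment, whereas \<open>f\<close> vanishes on the infinite set \<open>Z\<close>.\<close>
    let ?K = "complex_of_real ` {-A..A}"
    have "f holomorphic_on UNIV" unfolding f_def by (intro holomorphic_intros holo)
    moreover have "compact ?K" by (intro compact_continuous_image continuous_intros) auto
    ultimately have "finite {z \<in> ?K. f z = 0}"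
      using nc by (intro holomorphic_compact_finite_zeros[of f UNIV ?K]) auto
    moreover have "complex_of_real ` Z \<subseteq> {z \<in> ?K. f z = 0}"
      by (auto simp: Z_def f_def hu)
    ultimately have "finite (complex_of_real ` Z)" by (rule rev_finite_subset)
    then have "finite Z" by (rule finite_imageD) (auto simp: inj_on_def)
    with \<open>infinite Z\<close> show False by simp
  qed
  then obtain c where "\<And>z. f z = c" by (auto simp: constant_on_def)
  then have "h z = h 0" for z by (metis add_diff_cancel_left' diff_add_cancel f_def)
  then show ?thesis using h0 by auto
qed

section \<open>Completeness\<close>

text \<open>The entire extension of \<open>G n (expo t)\<close>: the squared modulus of the Fourier
  transform at \<open>t - freq R w\<close> becomes a product of values at opposite points.\<close>

definition H :: "nat \<Rightarrow> complex \<Rightarrow> complex" where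
  "H n z = (\<Sum>w\<in>words L n. complex_of_real ((cmod (prod_list (map \<alpha> w)))\<^sup>2)
     * fourier (z - of_int (freq R w)) * fourier (of_int (freq R w) - z))"

lemma H_holomorphic: "H n holomorphic_on UNIV"
proof -
  have "(\<lambda>z. fourier (g z)) holomorphic_on UNIV" if "g holomorphic_on UNIV" for g
    using holomorphic_on_compose[OF that fourier_holomorphic] by (simp add: comp_def)
  note this [holomorphic_intros]
  show ?thesis unfolding H_def by (intro holomorphic_intros)
qed

lemma L2_inner_cexpo_frame:
  "L2_inner \<mu> (cexpo z) (frame_elem R \<alpha> w) = cnj (prod_list (map \<alpha> w)) * fourier (z - of_int (freq R w))"
proof -
  have "cexpo z x * cnj (frame_elem R \<alpha> w x)
      = cnj (prod_list (map \<alpha> w)) * cexpo (z - of_int (freq R w)) x" for x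
    using cexpo_mult_cnj_expo[of z x "of_int (freq R w)"] by (simp add: frame_elem_def mult_ac)
  then show ?thesis by (simp add: L2_inner_def fourier_def)
qed

text \<open>Pairing \<open>z\<close> with \<open>cnj z\<close> exposes inner products of two
  square-integrable functions, to each of which the Bessel inequality applies.\<close>

lemma H_eq: "H n z = (\<Sum>w\<in>words L n. L2_inner \<mu> (cexpo z) (frame_elem R \<alpha> w)
    * cnj (L2_inner \<mu> (cexpo (cnj z)) (frame_elem R \<alpha> w)))"
  unfolding H_def L2_inner_cexpo_frame
  by (intro sum.cong refl) (simp add: cnj_fourier complex_norm_square mult_ac del: of_real_power)

lemma H_of_real: "H n (of_real t) = of_real (G n (expo t))"
  by (simp add: H_eq G_def cexpo_of_real complex_norm_square del: of_real_power)

text \<open>The arithmetic-geometric mean inequality and Bessel for \<open>z\<close> and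
  \<open>cnj z\<close> give a bound independent of \<open>n\<close>, which is the local boundedness
  that Montel's theorem requires.\<close>

lemma H_bound: "cmod (H n z) \<le> (exp (2 * pi * cmod z * (digit_bound + 1)))\<^sup>2"
proof -
  let ?F = "\<lambda>z w. cmod (L2_inner \<mu> (cexpo z) (frame_elem R \<alpha> w))"
  let ?E = "(exp (2 * pi * cmod z * (digit_bound + 1)))\<^sup>2"
  have G: "G n (cexpo y) \<le> ?E" if y: "cmod y = cmod z" for y
  proof -
    have "G n (cexpo y) \<le> L2_normsq \<mu> (cexpo y)" by (rule bessel[OF cexpo_L2])
    also have "\<dots> \<le> (\<integral>x. ?E \<partial>\<mu>)"
      unfolding L2_normsq_def
    proof (rule integral_mono_AE)
      show "AE x in \<mu>. (cmod (cexpo y x))\<^sup>2 \<le> ?E"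
        using support
      proof eventually_elim
        case (elim x)
        show ?case using cmod_cexpo_le[OF elim, of y] y by (intro power_mono) auto
      qed
    qed (use L2_integrable[OF cexpo_L2] in auto)
    finally show ?thesis using prob_space by simp
  qed
  have "cmod (H n z) \<le> (\<Sum>w\<in>words L n. ?F z w * ?F (cnj z) w)"
    unfolding H_eq by (rule order.trans[OF norm_sum]) (simp add: norm_mult)
  also have "\<dots> \<le> (\<Sum>w\<in>words L n. ((?F z w)\<^sup>2 + (?F (cnj z) w)\<^sup>2) / 2)"
  proof (rule sum_mono)
    fix w
    show "?F z w * ?F (cnj z) w \<le> ((?F z w)\<^sup>2 + (?F (cnj z) w)\<^sup>2) / 2"
      using sum_squares_bound[of "?F z w" "?F (cnj z) w"] by simp
  qed
  also have "\<dots> = (G n (cexpo z) + G n (cexpo (cnj z))) / 2"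
    by (simp add: G_def sum.distrib flip: sum_divide_distrib)
  also have "\<dots> \<le> ?E" using G[of z] G[of "cnj z"] by simp
  finally show ?thesis .
qed

lemma G_expo_le_1: "G n (expo t) \<le> 1"
  using bessel[OF expo_L2, of n t] by (simp add: L2_normsq_expo)

lemma G_nonneg: "0 \<le> G n f"
  by (simp add: G_def sum_nonneg)

lemma G_expo_Suc: "G (Suc n) (expo t) = (\<Sum>l\<in>L. weight l t * G n (expo (gl R l t)))"
  by (simp add: G_Suc[OF expo_L2] T_expo G_scale weight_def norm_mult power_mult_distrib)

text \<open>The empty word alone already contributes 1, and the Bessel inequality leaves no room for
  more.\<close>

lemma G_expo_0: "G n (expo 0) = 1"
proof -
  have "expo 0 = (\<lambda>_. 1)" by (simp add: fun_eq_iff)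
  then have "G 0 (expo 0) = 1" using prob_space by (simp add: G_0 L2_inner_def)
  moreover have "G 0 (expo 0) \<le> G n (expo 0)" by (rule incseqD[OF G_incseq]) simp
  ultimately show ?thesis using G_expo_le_1[of n 0] by simp
qed

text \<open>Montel's theorem gives only a subsequence. On the real line \<open>G n (expo t)\<close>
  increases and is bounded, so the whole sequence has the same limit; the recursion, which shifts
  \<open>n\<close>, therefore passes to the limit and makes it a fixed point.\<close>

lemma G_expo_tendsto_1:
  assumes only0: "\<And>M. finite_minimal_invariant R B L \<alpha> M \<Longrightarrow> M = {0}"
  shows "(\<lambda>n. G n (expo t)) \<longlonglongrightarrow> 1"
proof -
  have bounded: "\<exists>C. \<forall>h\<in>range H. \<forall>z\<in>K. cmod (h z) \<le> C" if "compact K" for K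
  proof -
    obtain b where b: "\<forall>z\<in>K. cmod z \<le> b" using compact_imp_bounded[OF \<open>compact K\<close>] bounded_iff by blast
    have "cmod (H n z) \<le> (exp (2 * pi * b * (digit_bound + 1)))\<^sup>2" if "z \<in> K" for n z
    proof -
      note H_bound[of n z]
      also have "(exp (2 * pi * cmod z * (digit_bound + 1)))\<^sup>2 \<le> (exp (2 * pi * b * (digit_bound + 1)))\<^sup>2"
        using b that digit_bound_nonneg by (intro power_mono) (auto intro!: mult_right_mono)
      finally show ?thesis .
    qed
    then show ?thesis by blast
  qed
  obtain h k where h: "h holomorphic_on UNIV" "strict_mono (k :: nat \<Rightarrow> nat)"
      "\<And>z. (\<lambda>n. H (k n) z) \<longlonglongrightarrow> h z"
  proof (rule Montel[of UNIV "range H" H])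
    show "h holomorphic_on UNIV" if "h \<in> range H" for h
      using that H_holomorphic by blast
  qed (use bounded in simp_all)
  have lim: "(\<lambda>n. G n (expo t)) \<longlonglongrightarrow> Re (h (of_real t))" and real: "h (of_real t) \<in> \<real>" for t
  proof -
    obtain s where s: "(\<lambda>n. G n (expo t)) \<longlonglongrightarrow> s"
      using incseq_convergent[OF G_incseq] G_expo_le_1 by metis
    then have "(\<lambda>n. complex_of_real (G (k n) (expo t))) \<longlonglongrightarrow> of_real s"
      by (intro tendsto_of_real LIMSEQ_subseq_LIMSEQ[OF s h(2), unfolded comp_def])
    then have "h (of_real t) = of_real s"
      using h(3)[of "of_real t"] by (simp add: H_of_real LIMSEQ_unique)
    then show "(\<lambda>n. G n (expo t)) \<longlonglongrightarrow> Re (h (of_real t))" "h (of_real t) \<in> \<real>"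
      using s by auto
  qed
  have h_Re: "h (of_real t) = of_real (Re (h (of_real t)))" for t
    using real[of t] by (simp add: complex_is_Real_iff complex_eq_iff)
  have "h = (\<lambda>_. 1)"
  proof (rule entire_fixed_point_eq_1[OF only0 h(1) real])
    show "Re (h (of_real t)) \<le> 1" for t
      by (rule LIMSEQ_le_const2[OF lim]) (auto simp: G_expo_le_1)
    have "(\<lambda>n. G n (expo 0)) \<longlonglongrightarrow> 1" by (simp add: G_expo_0)
    then have "Re (h 0) = 1" using lim[of 0] LIMSEQ_unique by force
    then show "h 0 = 1" using h_Re[of 0] by simp
    fix t
    have "(\<lambda>n. G (Suc n) (expo t)) \<longlonglongrightarrow> (\<Sum>l\<in>L. weight l t * Re (h (of_real (gl R l t))))"
      unfolding G_expo_Suc by (intro tendsto_intros lim)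
    then have "(\<Sum>l\<in>L. weight l t * Re (h (of_real (gl R l t)))) = Re (h (of_real t))"
      using LIMSEQ_Suc[OF lim] LIMSEQ_unique by blast
    then have "complex_of_real (\<Sum>l\<in>L. weight l t * Re (h (of_real (gl R l t)))) = h (of_real t)"
      using h_Re by simp
    then show "(\<Sum>l\<in>L. complex_of_real (weight l t) * h (of_real (gl R l t))) = h (of_real t)"
      by (simp flip: h_Re)
  qed
  then show ?thesis using lim[of t] by simp
qed

lemma defect_add_le:
  assumes "f \<in> L2 \<mu>" "g \<in> L2 \<mu>"
  shows "L2_normsq \<mu> (\<lambda>x. f x + g x) - G n (\<lambda>x. f x + g x)
    \<le> 2 * (L2_normsq \<mu> f - G n f) + 2 * (L2_normsq \<mu> g - G n g)"
proof -
  have arith: "a - a' \<le> 2 * (c - c') + 2 * (d - d')"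
    if "a + b = 2 * c + 2 * d" "a' + b' = 2 * c' + 2 * d'" "b' \<le> b" for a b c d a' b' c' d' :: real
  proof -
    have "a = 2 * c + 2 * d - b" "a' = 2 * c' + 2 * d' - b'" using that by linarith+
    then show ?thesis using that(3) by simp
  qed
  show ?thesis
    by (rule arith[OF L2_normsq_parallelogram[OF assms] G_parallelogram[OF assms]
          bessel[OF L2_diff[OF assms]]])
qed

lemma defect_trig_poly_tendsto_0:
  assumes only0: "\<And>M. finite_minimal_invariant R B L \<alpha> M \<Longrightarrow> M = {0}"
    and "trig_poly p"
  shows "(\<lambda>n. L2_normsq \<mu> p - G n p) \<longlonglongrightarrow> 0"
  using assms(2)
proof (induction rule: trig_poly.induct)
  case (trig_poly_expo t)
  have "(\<lambda>n. L2_normsq \<mu> (expo t) - G n (expo t)) \<longlonglongrightarrow> 1 - 1"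
    unfolding L2_normsq_expo by (intro tendsto_intros G_expo_tendsto_1 only0)
  then show ?case by simp
next
  case (trig_poly_scale p c)
  have "(\<lambda>n. (cmod c)\<^sup>2 * (L2_normsq \<mu> p - G n p)) \<longlonglongrightarrow> (cmod c)\<^sup>2 * 0"
    by (intro tendsto_intros trig_poly_scale)
  then show ?case by (simp add: L2_normsq_scale G_scale right_diff_distrib)
next
  case (trig_poly_add p q)
  have L: "p \<in> L2 \<mu>" "q \<in> L2 \<mu>" using trig_poly_add by (simp_all add: trig_poly_in_L2)
  have "(\<lambda>n. 2 * (L2_normsq \<mu> p - G n p) + 2 * (L2_normsq \<mu> q - G n q)) \<longlonglongrightarrow> 2 * 0 + 2 * 0"
    by (intro tendsto_intros trig_poly_add)
  then have lim: "(\<lambda>n. 2 * (L2_normsq \<mu> p - G n p) + 2 * (L2_normsq \<mu> q - G n q)) \<longlonglongrightarrow> 0" by simp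
  show ?case
  proof (rule tendsto_sandwich[OF _ _ tendsto_const lim])
    show "\<forall>\<^sub>F n in sequentially. 0 \<le> L2_normsq \<mu> (\<lambda>x. p x + q x) - G n (\<lambda>x. p x + q x)"
      using bessel[OF L2_add[OF L]] by simp
    show "\<forall>\<^sub>F n in sequentially. L2_normsq \<mu> (\<lambda>x. p x + q x) - G n (\<lambda>x. p x + q x)
        \<le> 2 * (L2_normsq \<mu> p - G n p) + 2 * (L2_normsq \<mu> q - G n q)"
      by (intro always_eventually allI defect_add_le[OF L])
  qed
qed

text \<open>Write \<open>f\<close> as the sum of \<open>f - p\<close> and \<open>p\<close>. The
  defect of \<open>f - p\<close> is at most its squared norm, small for all \<open>n\<close> at
  once, and that of \<open>p\<close> tends to 0; twice a quarter from each gives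
  \<open>e\<close>.\<close>

lemma parseval:
  assumes only0: "\<And>M. finite_minimal_invariant R B L \<alpha> M \<Longrightarrow> M = {0}"
  shows "parseval_frame \<mu> (Omega L) (frame_elem R \<alpha>)"
  unfolding parseval_frame_def
proof (intro ballI has_sum_frame LIMSEQ_I)
  fix f and e :: real assume f: "f \<in> L2 \<mu>" and e: "0 < e"
  obtain p where p: "trig_poly p" "L2_normsq \<mu> (\<lambda>x. f x - p x) < e / 4"
    using trig_poly_dense[OF f] e unfolding trig_approximable_def
    by (metis divide_pos_pos zero_less_numeral)
  have pL: "p \<in> L2 \<mu>" using p by (simp add: trig_poly_in_L2)
  have "\<forall>\<^sub>F n in sequentially. L2_normsq \<mu> p - G n p < e / 4"
    using e by (intro order_tendstoD(2)[OF defect_trig_poly_tendsto_0[OF only0 p(1)]]) auto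
  then obtain N where N: "\<And>n. n \<ge> N \<Longrightarrow> L2_normsq \<mu> p - G n p < e / 4"
    by (auto simp: eventually_sequentially)
  have "norm (G n f - L2_normsq \<mu> f) < e" if "n \<ge> N" for n
  proof -
    have "L2_normsq \<mu> f - G n f \<le> 2 * (L2_normsq \<mu> (\<lambda>x. f x - p x) - G n (\<lambda>x. f x - p x))
        + 2 * (L2_normsq \<mu> p - G n p)"
      using defect_add_le[OF L2_diff[OF f pL] pL, of n] by simp
    also have "\<dots> < e"
      using N[OF that] p(2) G_nonneg[of n "\<lambda>x. f x - p x"] by simp
    finally show ?thesis using bessel[OF f, of n] by simp
  qed
  then show "\<exists>N. \<forall>n\<ge>N. norm (G n f - L2_normsq \<mu> f) < e" by blast
qed

section \<open>Orthogonality to the other finite minimal invariant sets\<close>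

text \<open>At the point 0 the digit 0 already has weight 1, so all other digits have weight 0 and
  \<open>{0}\<close> is invariant. A minimal set containing 0 would equal it.\<close>

lemma zero_notin_minimal:
  assumes M: "finite_minimal_invariant R B L \<alpha> M" "M \<noteq> {0}"
  shows "0 \<notin> M"
proof
  assume "0 \<in> M"
  with M(2) have "{0} \<subset> M" by blast
  moreover have "invariant_set R B L \<alpha> {0}"
    unfolding invariant_set_def
  proof (intro ballI impI)
    fix t :: real and l
    assume t: "t \<in> {0}" and l: "l \<in> L" and nz: "\<alpha> l * mB B (gl R l t) \<noteq> 0"
    have "l = 0"
    proof (rule ccontr)
      assume "l \<noteq> 0"
      have "mB B 0 = 1" using card_B by (simp add: mB_def)
      then have "weight 0 0 = 1" by (simp add: weight_def a0 gl_def)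
      moreover have "(\<Sum>k\<in>L. weight k 0) = weight 0 0 + (\<Sum>k\<in>L - {0}. weight k 0)"
        using L by (rule sum.remove)
      ultimately have "(\<Sum>k\<in>L - {0}. weight k 0) = 0" by (simp add: sum_weight)
      then have "weight l 0 = 0"
        using L(1) l \<open>l \<noteq> 0\<close> by (subst (asm) sum_nonneg_eq_0_iff) (auto simp: weight_nonneg)
      then show False using nz t by (simp add: weight_def)
    qed
    then show "gl R l t \<in> {0}" using t by (simp add: gl_def)
  qed
  ultimately show False using M(1) by (auto simp: finite_minimal_invariant_def)
qed

text \<open>If \<open>c \<in> M\<close> had a nonzero Fourier coefficient, the digit \<open>0\<close> would lead from \<open>c\<close> to
  \<open>c / R\<close>, which again lies in \<open>M\<close> and has a nonzero coefficient; iterating makes \<open>M\<close> infinite.\<close>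

lemma fourier_minimal_eq_0:
  assumes M: "finite_minimal_invariant R B L \<alpha> M" "M \<noteq> {0}" and c: "c \<in> M"
  shows "L2_inner \<mu> (expo c) (\<lambda>_. 1) = 0"
proof (rule ccontr)
  assume nz: "L2_inner \<mu> (expo c) (\<lambda>_. 1) \<noteq> 0"
  have inv: "invariant_set R B L \<alpha> M" and fin: "finite M"
    using M by (simp_all add: finite_minimal_invariant_def)
  have iter: "c / R ^ n \<in> M \<and> L2_inner \<mu> (expo (c / R ^ n)) (\<lambda>_. 1) \<noteq> 0" for n
  proof (induction n)
    case (Suc n)
    let ?t = "c / R ^ n"
    have eq: "gl R 0 ?t = c / R ^ Suc n" by (simp add: gl_def)
    have "mB B (?t / R) * L2_inner \<mu> (expo (?t / R)) (\<lambda>_. 1) \<noteq> 0"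
      using Suc fourier_mu[of ?t] by simp
    then have *: "mB B (gl R 0 ?t) \<noteq> 0" "L2_inner \<mu> (expo (gl R 0 ?t)) (\<lambda>_. 1) \<noteq> 0"
      by (auto simp: gl_def)
    moreover have "gl R 0 ?t \<in> M"
      using inv Suc L(2) *(1) a0 unfolding invariant_set_def by auto
    ultimately show ?case unfolding eq by simp
  qed (use c nz in simp)
  \<comment> \<open>A nonzero start and \<open>\<bar>R\<bar> \<ge> 2\<close> make the points of the
    orbit pairwise distinct.\<close>
  have c0: "c \<noteq> 0" using zero_notin_minimal[OF M] c by auto
  have "inj (\<lambda>n. c / R ^ n)"
  proof (rule injI)
    fix m n :: nat assume "c / R ^ m = c / R ^ n"
    then have "real_of_int R ^ m = real_of_int R ^ n" using c0 R_nz by (simp add: field_simps)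
    then have "\<bar>real_of_int R\<bar> ^ m = \<bar>real_of_int R\<bar> ^ n" by (metis power_abs)
    then show "m = n" using abs_R_ge by (subst (asm) power_inject_exp) auto
  qed
  then have "infinite (range (\<lambda>n. c / R ^ n))" by (rule range_inj_infinite)
  moreover have "range (\<lambda>n. c / R ^ n) \<subseteq> M" using iter by blast
  ultimately show False using fin finite_subset by blast
qed

text \<open>Splitting off the first letter moves \<open>c\<close> to \<open>gl R l c\<close>. Either
  this point stays in \<open>M\<close> or the accompanying coefficient vanishes, so induction over
  all \<open>c\<close> in \<open>M\<close> reduces to the empty word.\<close>

lemma expo_minimal_orthogonal:
  assumes M: "finite_minimal_invariant R B L \<alpha> M" "M \<noteq> {0}"
  shows "c \<in> M \<Longrightarrow> set w \<subseteq> L \<Longrightarrow> L2_inner \<mu> (expo c) (frame_elem R \<alpha> w) = 0"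
proof (induction w arbitrary: c)
  case Nil
  then show ?case using fourier_minimal_eq_0[OF M] by (simp add: frame_elem_Nil)
next
  case (Cons l w)
  have eq: "L2_inner \<mu> (expo c) (frame_elem R \<alpha> (l # w))
      = cnj (\<alpha> l) * mB B (gl R l c) * L2_inner \<mu> (expo (gl R l c)) (frame_elem R \<alpha> w)"
    by (simp add: L2_inner_frame_Cons[OF expo_L2] T_expo L2_inner_scale_left)
  show ?case
  proof (cases "\<alpha> l * mB B (gl R l c) = 0")
    case True
    then show ?thesis by (auto simp: eq)
  next
    case False
    then have "gl R l c \<in> M"
      using M(1) Cons.prems by (auto simp: finite_minimal_invariant_def invariant_set_def)
    then show ?thesis using Cons by (simp add: eq)
  qed
qed

end

theorem theorem4p4:
  fixes R :: int and B L :: "int set" and \<alpha> :: "int \<Rightarrow> complex" and \<mu> :: "real measure"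
  assumes R: "\<bar>R\<bar> \<ge> 2"
    and B: "finite B" "0 \<in> B"
    and mu: "invariant_measure R B \<mu>"
    and nov: "no_overlap R B \<mu>"
    and L: "finite L" "0 \<in> L"
    and a0: "\<alpha> 0 = 1"
    and orth: "\<forall>b\<in>B. \<forall>b'\<in>B.
       (\<Sum>l\<in>L. (1 / of_nat (card B)) *
          (expo (real_of_int l * real_of_int b / real_of_int R) 1 * \<alpha> l) *
          cnj (expo (real_of_int l * real_of_int b' / real_of_int R) 1 * \<alpha> l))
       = (if b = b' then 1 else 0)"
  shows "((\<forall>M. finite_minimal_invariant R B L \<alpha> M \<longrightarrow> M = {0}) \<longrightarrow>
            (\<forall>h :: complex \<Rightarrow> complex.
               h holomorphic_on UNIV \<and>
               (\<forall>t::real. h (of_real t) \<in> \<real> \<and> 0 \<le> Re (h (of_real t)) \<and> Re (h (of_real t)) \<le> 1) \<and>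
               h 0 = 1 \<and>
               (\<forall>t::real. (\<Sum>l\<in>L. complex_of_real ((cmod (\<alpha> l))\<^sup>2 * (cmod (mB B (gl R l t)))\<^sup>2)
                                   * h (of_real (gl R l t))) = h (of_real t))
               \<longrightarrow> h = (\<lambda>_. 1))
            \<and> parseval_frame \<mu> (Omega L) (frame_elem R \<alpha>))
       \<and> (\<forall>M. finite_minimal_invariant R B L \<alpha> M \<and> M \<noteq> {0} \<longrightarrow>
            (\<forall>c\<in>M. \<forall>w\<in>Omega L. L2_inner \<mu> (expo c) (frame_elem R \<alpha> w) = 0))"
proof -
  interpret ifs_frame R B \<mu> L \<alpha>
    by unfold_locales (use R B mu L a0 orth in auto)
  show ?thesis
  proof (intro conjI impI allI ballI)
    fix h :: "complex \<Rightarrow> complex"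
    assume only0: "\<forall>M. finite_minimal_invariant R B L \<alpha> M \<longrightarrow> M = {0}"
    assume h: "h holomorphic_on UNIV \<and>
       (\<forall>t::real. h (of_real t) \<in> \<real> \<and> 0 \<le> Re (h (of_real t)) \<and> Re (h (of_real t)) \<le> 1) \<and>
       h 0 = 1 \<and>
       (\<forall>t::real. (\<Sum>l\<in>L. complex_of_real ((cmod (\<alpha> l))\<^sup>2 * (cmod (mB B (gl R l t)))\<^sup>2)
                           * h (of_real (gl R l t))) = h (of_real t))"
    show "h = (\<lambda>_. 1)"
      by (rule entire_fixed_point_eq_1) (use only0 h in \<open>simp_all add: weight_def\<close>)
  next
    assume "\<forall>M. finite_minimal_invariant R B L \<alpha> M \<longrightarrow> M = {0}"
    then show "parseval_frame \<mu> (Omega L) (frame_elem R \<alpha>)" by (intro parseval) blast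
  next
    fix M c w
    assume "finite_minimal_invariant R B L \<alpha> M \<and> M \<noteq> {0}" "c \<in> M" "w \<in> Omega L"
    then show "L2_inner \<mu> (expo c) (frame_elem R \<alpha> w) = 0"
      using expo_minimal_orthogonal by (auto simp: Omega_def)
  qed
qed

end
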